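(* For Lebesgue almost every $\alpha>1$, the sequences $(\alpha^{n^k})_{n=1}^{\infty}$ and $(\alpha^{n^k}+\alpha^{n^k-1}+\cdots+\alpha+1)_{n=1}^{\infty}$ have Poissonian pair correlations for all integers $k\geq 2$. Similarly, for Lebesgue almost every $\alpha>1$ the sequence $(\alpha^{n!})_{n=1}^{\infty}$ has Poissonian pair correlations.
   Context: For $x\in\mathbb{R}$, $\|x\|$ denotes the distance from $x$ to the nearest integer. A real sequence $(x_n)_{n=1}^{\infty}$ has Poissonian pair correlations if for every $s>0$, $$\lim_{N\to\infty}\frac{\#\{(m,n):1\leq m,n\leq N,\ m\neq n,\ \|x_n-x_m\|\leq \frac{s}{N}\}}{N}=2s.$$ *)

theory Defs
  imports "HOL-Analysis.Analysis"
begin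

definition dist_nearest_int :: "real \<Rightarrow> real" where
  "dist_nearest_int x = dist x (of_int (round x))"

(* Sequences are functions on nat of which only the values at indices n \<ge> 1 are used. *)
definition poissonian_pair_correlations :: "(nat \<Rightarrow> real) \<Rightarrow> bool" where
  "poissonian_pair_correlations x \<longleftrightarrow>
    (\<forall>s>0. (\<lambda>N. real (card {(m, n). m \<in> {1..N} \<and> n \<in> {1..N} \<and> m \<noteq> n \<and>
                            dist_nearest_int (x n - x m) \<le> s / real N}) / real N)
            \<longlonglongrightarrow> 2 * s)"

lemma dist_nearest_int_eq_infdist: "dist_nearest_int x = infdist x \<int>"
proof (rule antisym)
  have "dist x (of_int (round x)) \<le> dist x a" if "a \<in> \<int>" for a
    using that round_diff_minimal[of x] by (auto elim!: Ints_cases simp: dist_real_def)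
  then show "dist_nearest_int x \<le> infdist x \<int>"
    unfolding dist_nearest_int_def infdist_def
    by (auto intro!: cINF_greatest)
  show "infdist x \<int> \<le> dist_nearest_int x"
    unfolding dist_nearest_int_def by (rule infdist_le) auto
qed

end

theory Submission
  imports Defs "HOL-Real_Asymp.Real_Asymp" "HOL-Library.Discrete_Functions"
begin

text \<open>
  The proof is a second moment argument on a compact interval of parameters \<open>\<alpha>\<close>.
  For \<open>m < n\<close> the difference \<open>x\<^sub>n - x\<^sub>m\<close> is an increasing convex function of \<open>\<alpha>\<close> with a large
  derivative, so the second mean value theorem shows that it is equidistributed modulo 1 with an error
  inversely proportional to its derivative. If \<open>n' < n\<close>, then \<open>x\<^sub>n - x\<^sub>m\<close> oscillates so much faster
  than \<open>x\<^sub>n\<^sub>' - x\<^sub>m\<^sub>'\<close> that the events of being near an integer are almost independent. For pairs with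
  the same larger index, closeness of \<open>x\<^sub>n\<close> to both \<open>x\<^sub>m\<close> and \<open>x\<^sub>m\<^sub>'\<close> forces closeness of \<open>x\<^sub>m\<close>
  to \<open>x\<^sub>m\<^sub>'\<close>, which again leads to pairs with different larger indices. Hence the variance of the
  number of close pairs among the first \<open>N\<close> terms is \<open>O(N)\<close>. This gives almost sure convergence along
  the squares \<open>N = j\<^sup>2\<close>, and monotonicity in \<open>N\<close> and in \<open>s\<close> fills the gaps.
\<close>

subsection \<open>Equidistribution of functions with large derivative\<close>

text \<open>\<open>dist_nearest_int t\<close> is one of \<open>frac t\<close> and
  \<open>1 - frac t\<close>, and the product is symmetric in the two. Hence the quadratic in
  \<open>frac\<close> is continuous, with no jump at the integers.\<close>

lemma frac_times_one_minus_frac: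
  "frac t * (1 - frac t) = dist_nearest_int t * (1 - dist_nearest_int t)"
proof -
  have "dist_nearest_int t = frac t \<or> dist_nearest_int t = 1 - frac t"
  proof -
    have "round t = \<lfloor>t\<rfloor> \<and> t - of_int \<lfloor>t\<rfloor> \<ge> 0 \<or> round t = \<lfloor>t\<rfloor> + 1 \<and> t - of_int \<lfloor>t\<rfloor> \<le> 1"
      unfolding round_def by linarith
    then show ?thesis by (auto simp: dist_nearest_int_def dist_real_def frac_def)
  qed
  then show ?thesis by auto
qed

lemma continuous_on_frac_quadratic: "continuous_on S (\<lambda>t::real. (frac t)\<^sup>2 - frac t)"
proof -
  have "(\<lambda>t::real. (frac t)\<^sup>2 - frac t) = (\<lambda>t. - (infdist t \<int> * (1 - infdist t \<int>)))"
    using frac_times_one_minus_frac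
    by (auto simp: fun_eq_iff dist_nearest_int_eq_infdist algebra_simps power2_eq_square)
  then show ?thesis by (simp only:) (intro continuous_intros)
qed

lemma frac_has_real_derivative:
  fixes t :: real
  assumes "t \<notin> \<int>"
  shows "(frac has_real_derivative 1) (at t)"
proof -
  have "((\<lambda>x. x - real_of_int \<lfloor>x\<rfloor>) has_real_derivative 1 - 0) (at t)"
    using assms by (intro derivative_intros floor_has_real_derivative) auto
  then show ?thesis by (simp add: frac_def[abs_def])
qed

lemma measurable_frac [measurable]: "(frac :: real \<Rightarrow> real) \<in> borel_measurable borel"
  unfolding frac_def[abs_def] by measurable

lemma bounded_borel_integrable_on:
  fixes f :: "real \<Rightarrow> real"
  assumes "f \<in> borel_measurable borel" "\<And>x. \<bar>f x\<bar> \<le> C"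
  shows "f integrable_on {a..b}"
proof (rule measurable_bounded_by_integrable_imp_integrable)
  show "f \<in> borel_measurable (lebesgue_on {a..b})"
    using assms(1) by (simp add: measurable_completion measurable_restrict_space1)
qed (use assms in \<open>auto intro: integrable_const_ivl\<close>)

text \<open>These points are the exceptional set that the fundamental theorem of calculus must
  tolerate: a strictly monotone function meets each of the finitely many integers in its range at
  most once.\<close>

lemma finite_level_Ints:
  fixes g :: "real \<Rightarrow> real"
  assumes "strict_mono_on {a..b} g"
  shows "finite {x\<in>{a..b}. g x \<in> \<int>}"
proof (rule finite_imageD)
  have "g ` {x\<in>{a..b}. g x \<in> \<int>} \<subseteq> {n\<in>\<int>. g a \<le> n \<and> n \<le> g b}"
    using strict_mono_on_leD[OF assms] by auto
  then show "finite (g ` {x\<in>{a..b}. g x \<in> \<int>})"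
    by (rule finite_subset) (rule finite_int_segment)
  show "inj_on g {x\<in>{a..b}. g x \<in> \<int>}"
    using strict_mono_on_imp_inj_on[OF assms] by (rule inj_on_subset) auto
qed

lemma strict_mono_on_of_deriv:
  fixes g g' :: "real \<Rightarrow> real"
  assumes der: "\<And>x. x \<in> {a..b} \<Longrightarrow> (g has_real_derivative g' x) (at x)"
    and mono: "mono_on {a..b} g'" and pos: "g' a > 0"
  shows "strict_mono_on {a..b} g"
proof (rule strict_mono_onI)
  fix x y assume xy: "x \<in> {a..b}" "y \<in> {a..b}" "x < y"
  show "g x < g y"
  proof (rule DERIV_pos_imp_increasing[OF \<open>x < y\<close>])
    fix z assume "x \<le> z" "z \<le> y"
    then have "z \<in> {a..b}" "a \<in> {a..b}" using xy by auto
    then have "g' a \<le> g' z" using monotone_onD[OF mono] by auto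
    then show "\<exists>d. (g has_real_derivative d) (at z) \<and> 0 < d"
      using der[OF \<open>z \<in> {a..b}\<close>] pos by (intro exI[of _ "g' z"]) auto
  qed
qed

text \<open>The integrand is \<open>1 / g'\<close> times the derivative of a bounded function of
  \<open>g\<close>. As \<open>1 / g'\<close> is monotone, the second mean value theorem replaces it
  by its two endpoint values.\<close>

lemma sawtooth_integral_bound:
  fixes g g' :: "real \<Rightarrow> real"
  assumes ab: "a \<le> b"
    and der: "\<And>x. x \<in> {a..b} \<Longrightarrow> (g has_real_derivative g' x) (at x)"
    and mono: "mono_on {a..b} g'" and pos: "g' a > 0"
  shows "\<bar>integral {a..b} (\<lambda>x. frac (g x) - 1/2)\<bar> \<le> 1 / (4 * g' a)"
proof -
  \<comment> \<open>A periodic continuous antiderivative of the sawtooth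
    \<open>frac t - 1/2\<close>; it oscillates by at most 1/8.\<close>
  define \<beta> :: "real \<Rightarrow> real" where "\<beta> t = ((frac t)\<^sup>2 - frac t) / 2" for t
  define f where "f x = (frac (g x) - 1/2) * g' x" for x
  have gpos: "g' x \<ge> g' a" "g' x > 0" if "x \<in> {a..b}" for x
  proof -
    show "g' x \<ge> g' a" using monotone_onD[OF mono, of a x] that by auto
    then show "g' x > 0" using pos by simp
  qed
  have sm: "strict_mono_on {a..b} g"
    by (rule strict_mono_on_of_deriv[OF der mono pos])
  have f_int: "(f has_integral (\<beta> (g v) - \<beta> (g u))) {u..v}"
    if uv: "u \<in> {a..b}" "v \<in> {a..b}" "u \<le> v" for u v
  proof (rule fundamental_theorem_of_calculus_strong[OF finite_level_Ints[OF sm] uv(3)])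
    fix x assume x: "x \<in> {u..v} - {x \<in> {a..b}. g x \<in> \<int>}"
    then have x': "x \<in> {a..b}" "g x \<notin> \<int>" using uv by auto
    have "((\<lambda>x. frac (g x)) has_real_derivative 1 * g' x) (at x)"
      by (rule DERIV_chain2[OF frac_has_real_derivative[OF x'(2)] der[OF x'(1)]])
    then have "((\<lambda>x. ((frac (g x))\<^sup>2 - frac (g x)) / 2) has_real_derivative
        (2 * frac (g x) * g' x - g' x) / 2) (at x)"
      by (auto intro!: derivative_eq_intros)
    then show "((\<lambda>x. \<beta> (g x)) has_vector_derivative f x) (at x)"
      unfolding \<beta>_def f_def has_real_derivative_iff_has_vector_derivative[symmetric]
      by (simp add: field_simps)
  next
    have "continuous_on {u..v} g"
      using uv by (intro continuous_at_imp_continuous_on ballI DERIV_isCont[OF der]) auto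
    then show "continuous_on {u..v} (\<lambda>x. \<beta> (g x))"
      unfolding \<beta>_def
      by (intro continuous_intros continuous_on_compose2[OF continuous_on_frac_quadratic[of UNIV]]) auto
  qed
  \<comment> \<open>The second mean value theorem is used in its form for a nondecreasing weight,
    hence the sign; it is undone in the final identity.\<close>
  have "- (1 / g' x) \<le> - (1 / g' y)" if "a \<le> x" "x \<le> y" "y \<le> b" for x y
    using gpos[of x] monotone_onD[OF mono, of x y] that by (auto intro!: divide_left_mono)
  moreover have "f integrable_on {a..b}"
    using f_int[of a b] ab by (auto intro: has_integral_integrable)
  ultimately obtain c where c: "c \<in> {a..b}"
    and I: "((\<lambda>x. - (1 / g' x) * f x) has_integral
        (- (1 / g' a) * integral {a..c} f + - (1 / g' b) * integral {c..b} f)) {a..b}"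
    using second_mean_value_theorem_full[of f a b "\<lambda>x. - (1 / g' x)"] ab by blast
  have \<beta>: "- 1 / 8 \<le> \<beta> t \<and> \<beta> t \<le> 0" for t
  proof -
    have "(frac t - 1/2)\<^sup>2 \<ge> 0" by simp
    moreover have "frac t * frac t \<le> frac t * 1"
      using frac_lt_1[of t] by (intro mult_left_mono) auto
    ultimately show ?thesis unfolding \<beta>_def by (simp add: power2_eq_square algebra_simps)
  qed
  have "\<bar>integral {u..v} f\<bar> \<le> 1 / 8" if "u \<in> {a..b}" "v \<in> {a..b}" "u \<le> v" for u v
    using integral_unique[OF f_int[OF that]] \<beta>[of "g v"] \<beta>[of "g u"] by linarith
  then have b1: "\<bar>integral {a..c} f\<bar> \<le> 1 / 8" and b2: "\<bar>integral {c..b} f\<bar> \<le> 1 / 8"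
    using c by auto
  have "\<bar>1 / g' a * integral {a..c} f\<bar> \<le> 1 / g' a * (1 / 8)"
    unfolding abs_mult using b1 pos by (intro mult_mono) auto
  moreover have "\<bar>1 / g' b * integral {c..b} f\<bar> \<le> 1 / g' a * (1 / 8)"
    unfolding abs_mult using b2 pos gpos[of b] ab by (intro mult_mono) (auto intro!: divide_left_mono)
  moreover have "integral {a..b} (\<lambda>x. frac (g x) - 1/2) =
      1 / g' a * integral {a..c} f + 1 / g' b * integral {c..b} f"
  proof -
    have "((\<lambda>x. frac (g x) - 1/2) has_integral
        (1 / g' a * integral {a..c} f + 1 / g' b * integral {c..b} f)) {a..b}"
    proof (rule has_integral_eq[rotated])
      show "((\<lambda>x. - (- (1 / g' x) * f x)) has_integral
          (1 / g' a * integral {a..c} f + 1 / g' b * integral {c..b} f)) {a..b}"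
        using has_integral_neg[OF I] by (simp add: add.commute)
      show "- (- (1 / g' x) * f x) = frac (g x) - 1/2" if "x \<in> {a..b}" for x
        using gpos(2)[OF that] by (simp add: f_def)
    qed
    then show ?thesis by (rule integral_unique)
  qed
  ultimately have "\<bar>integral {a..b} (\<lambda>x. frac (g x) - 1/2)\<bar> \<le> 1 / g' a * (1 / 8) + 1 / g' a * (1 / 8)"
    by (simp only:) (rule order_trans[OF abs_triangle_ineq add_mono])
  then show ?thesis by (simp add: field_simps)
qed

text \<open>For \<open>0 \<le> \<delta> < 1/2\<close> this is the indicator of \<open>(t - \<delta>, t + \<delta>]\<close> containing an integer. It differs
  from the indicator of \<open>dist_nearest_int t \<le> \<delta>\<close> only at the boundary, and its centred version is
  exactly a difference of two sawtooth functions.\<close>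

definition near_int :: "real \<Rightarrow> real \<Rightarrow> real" where
  "near_int \<delta> t = of_int \<lfloor>t + \<delta>\<rfloor> - of_int \<lfloor>t - \<delta>\<rfloor>"

lemma near_int_eq_frac: "near_int \<delta> t - 2 * \<delta> = frac (t - \<delta>) - frac (t + \<delta>)"
  by (simp add: near_int_def frac_def)

lemma measurable_near_int [measurable]: "near_int \<delta> \<in> borel_measurable borel"
  unfolding near_int_def[abs_def] by measurable

lemma near_int_0_or_1:
  assumes "0 \<le> \<delta>" "\<delta> < 1/2"
  shows "near_int \<delta> t = 0 \<or> near_int \<delta> t = 1"
proof -
  have "\<lfloor>t + \<delta>\<rfloor> = \<lfloor>t - \<delta>\<rfloor> \<or> \<lfloor>t + \<delta>\<rfloor> = \<lfloor>t - \<delta>\<rfloor> + 1"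
    using assms by linarith
  then show ?thesis by (auto simp: near_int_def)
qed

lemma abs_near_int_minus_mean_le: "\<bar>near_int \<delta> t - 2 * \<delta>\<bar> \<le> 1"
  unfolding near_int_eq_frac
  using frac_lt_1[of "t-\<delta>"] frac_ge_0[of "t-\<delta>"] frac_lt_1[of "t+\<delta>"] frac_ge_0[of "t+\<delta>"] by linarith

text \<open>The centred indicator is a difference of two sawteeth along \<open>g - \<delta>\<close>
  and \<open>g + \<delta>\<close>, and the shifts leave the derivative unchanged. The bound is
  therefore uniform in \<open>\<delta>\<close>.\<close>

lemma osc_integral_bound:
  fixes g g' :: "real \<Rightarrow> real"
  assumes ab: "a \<le> b" and meas: "g \<in> borel_measurable borel"
    and der: "\<And>x. x \<in> {a..b} \<Longrightarrow> (g has_real_derivative g' x) (at x)"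
    and mono: "mono_on {a..b} g'" and pos: "g' a > 0"
  shows "\<bar>integral {a..b} (\<lambda>x. near_int \<delta> (g x) - 2 * \<delta>)\<bar> \<le> 1 / (2 * g' a)"
proof -
  note [measurable] = meas
  have saw: "\<bar>integral {a..b} (\<lambda>x. frac (g x + c) - 1/2)\<bar> \<le> 1 / (4 * g' a)" for c
    using der by (intro sawtooth_integral_bound[OF ab _ mono pos]) (auto intro!: derivative_eq_intros)
  have int: "(\<lambda>x. frac (g x + c) - 1/2) integrable_on {a..b}" for c
  proof (rule bounded_borel_integrable_on)
    show "\<bar>frac (g x + c) - 1/2\<bar> \<le> 1" for x
      using frac_lt_1[of "g x + c"] frac_ge_0[of "g x + c"] by linarith
  qed measurable
  have "integral {a..b} (\<lambda>x. near_int \<delta> (g x) - 2 * \<delta>) =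
      integral {a..b} (\<lambda>x. (frac (g x + (-\<delta>)) - 1/2) - (frac (g x + \<delta>) - 1/2))"
    unfolding near_int_eq_frac by simp
  also have "\<dots> = integral {a..b} (\<lambda>x. frac (g x + (-\<delta>)) - 1/2) - integral {a..b} (\<lambda>x. frac (g x + \<delta>) - 1/2)"
    by (rule integral_diff[OF int int])
  finally have "\<bar>integral {a..b} (\<lambda>x. near_int \<delta> (g x) - 2 * \<delta>)\<bar> \<le> 1 / (4 * g' a) + 1 / (4 * g' a)"
    using saw[of "-\<delta>"] saw[of \<delta>] by linarith
  then show ?thesis by (simp add: field_simps)
qed

section \<open>Correlation of a fast oscillation with a slower indicator\<close>

text \<open>While \<open>f\<close> grows by at most 1, the floor difference is a nondecreasing
  weight that starts at 0 and ends at 0 or 1. The second mean value theorem then leaves at most the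
  integral of \<open>h\<close> over a tail \<open>{c..b}\<close>.\<close>

lemma integral_mult_floor_bound:
  fixes h f :: "real \<Rightarrow> real"
  assumes ab: "a \<le> b" and h: "h integrable_on {a..b}"
    and M: "\<And>u. u \<in> {a..b} \<Longrightarrow> \<bar>integral {u..b} h\<bar> \<le> M"
    and f: "mono_on {a..b} f" and inc: "f b - f a \<le> 1"
  shows "(\<lambda>x. h x * (of_int \<lfloor>f x\<rfloor> - of_int \<lfloor>f a\<rfloor>)) integrable_on {a..b}"
    and "\<bar>integral {a..b} (\<lambda>x. h x * (of_int \<lfloor>f x\<rfloor> - of_int \<lfloor>f a\<rfloor>))\<bar> \<le> M"
proof -
  define w where "w x = real_of_int \<lfloor>f x\<rfloor> - of_int \<lfloor>f a\<rfloor>" for x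
  have "w x \<le> w y" if "a \<le> x" "x \<le> y" "y \<le> b" for x y
    using monotone_onD[OF f, of x y] that by (auto simp: w_def floor_mono)
  then obtain c where c: "c \<in> {a..b}"
    and I: "((\<lambda>x. w x * h x) has_integral (w a * integral {a..c} h + w b * integral {c..b} h)) {a..b}"
    using second_mean_value_theorem_full[OF h ab, of w] by blast
  have "w a = 0" by (simp add: w_def)
  then have I': "((\<lambda>x. h x * w x) has_integral (w b * integral {c..b} h)) {a..b}"
    using I by (simp add: mult.commute)
  have "f a \<le> f b" using monotone_onD[OF f, of a b] ab by auto
  then have "\<lfloor>f b\<rfloor> = \<lfloor>f a\<rfloor> \<or> \<lfloor>f b\<rfloor> = \<lfloor>f a\<rfloor> + 1" using inc by linarith
  then have "w b = 0 \<or> w b = 1" by (auto simp: w_def)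
  then have *: "\<bar>w b * integral {c..b} h\<bar> \<le> M" using M[OF c] by auto
  show "(\<lambda>x. h x * (of_int \<lfloor>f x\<rfloor> - of_int \<lfloor>f a\<rfloor>)) integrable_on {a..b}"
    using I' unfolding w_def by (rule has_integral_integrable)
  show "\<bar>integral {a..b} (\<lambda>x. h x * (of_int \<lfloor>f x\<rfloor> - of_int \<lfloor>f a\<rfloor>))\<bar> \<le> M"
    using * integral_unique[OF I'] unfolding w_def by simp
qed

text \<open>The slow indicator is its value at \<open>a\<close> plus the difference of two floor
  increments, taken at the shifts \<open>\<epsilon>\<close> and \<open>- \<epsilon>\<close>. Each of
  the three terms costs at most \<open>1 / (2 * g' a)\<close>.\<close>

lemma osc_near_int_integral_short:
  fixes g g' f :: "real \<Rightarrow> real"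
  assumes ab: "a \<le> b" and meas: "g \<in> borel_measurable borel"
    and der: "\<And>x. x \<in> {a..b} \<Longrightarrow> (g has_real_derivative g' x) (at x)"
    and mono: "mono_on {a..b} g'" and pos: "g' a > 0"
    and f: "mono_on {a..b} f" and inc: "f b - f a \<le> 1"
    and \<epsilon>: "0 \<le> \<epsilon>" "\<epsilon> < 1/2"
  shows "\<bar>integral {a..b} (\<lambda>x. (near_int \<delta> (g x) - 2 * \<delta>) * near_int \<epsilon> (f x))\<bar> \<le> 3/2 * (1 / g' a)"
proof -
  note [measurable] = meas
  define h where "h x = near_int \<delta> (g x) - 2 * \<delta>" for x
  have h: "h integrable_on {a..b}"
    unfolding h_def by (rule bounded_borel_integrable_on[OF _ abs_near_int_minus_mean_le]) measurable
  have M: "\<bar>integral {u..b} h\<bar> \<le> 1 / (2 * g' a)" if u: "u \<in> {a..b}" for u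
  proof -
    have "g' a \<le> g' u" using monotone_onD[OF mono, of a u] u by auto
    moreover have "\<bar>integral {u..b} h\<bar> \<le> 1 / (2 * g' u)"
      unfolding h_def
    proof (rule osc_integral_bound[OF _ meas])
      show "mono_on {u..b} g'" using mono u by (auto simp: mono_on_def)
    qed (use u der \<open>g' a \<le> g' u\<close> pos in auto)
    moreover have "1 / (2 * g' u) \<le> 1 / (2 * g' a)"
      using \<open>g' a \<le> g' u\<close> pos by (intro divide_left_mono) auto
    ultimately show ?thesis by linarith
  qed
  define p where "p c x = h x * (real_of_int \<lfloor>f x + c\<rfloor> - of_int \<lfloor>f a + c\<rfloor>)" for c x
  have fc: "mono_on {a..b} (\<lambda>x. f x + c)" for c using f by (auto simp: mono_on_def)
  have p: "p c integrable_on {a..b}" "\<bar>integral {a..b} (p c)\<bar> \<le> 1 / (2 * g' a)" for c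
    using integral_mult_floor_bound[OF ab h M fc[of c]] inc by (auto simp: p_def[abs_def])
  have "integral {a..b} (\<lambda>x. h x * near_int \<epsilon> (f x)) =
      integral {a..b} (\<lambda>x. p \<epsilon> x - p (-\<epsilon>) x + near_int \<epsilon> (f a) * h x)"
    by (intro integral_cong) (simp add: p_def near_int_def algebra_simps)
  also have "\<dots> = integral {a..b} (p \<epsilon>) - integral {a..b} (p (-\<epsilon>)) + near_int \<epsilon> (f a) * integral {a..b} h"
    using p(1) h by (subst integral_add) (auto intro!: integrable_diff integrable_on_mult_right simp: integral_diff)
  finally have eq: "integral {a..b} (\<lambda>x. h x * near_int \<epsilon> (f x)) =
    integral {a..b} (p \<epsilon>) - integral {a..b} (p (-\<epsilon>)) + near_int \<epsilon> (f a) * integral {a..b} h" .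
  have "\<bar>near_int \<epsilon> (f a) * integral {a..b} h\<bar> \<le> 1 / (2 * g' a)"
    using near_int_0_or_1[OF \<epsilon>, of "f a"] M[of a] ab pos by auto
  then have "\<bar>integral {a..b} (\<lambda>x. h x * near_int \<epsilon> (f x))\<bar> \<le> 1 / (2 * g' a) + 1 / (2 * g' a) + 1 / (2 * g' a)"
    unfolding eq using p(2)[of \<epsilon>] p(2)[of "-\<epsilon>"] by linarith
  then show ?thesis by (simp add: h_def field_simps)
qed

text \<open>The interval is cut into pieces on which \<open>f\<close> grows by at most 1. The
  comparison \<open>K * f' x \<le> g' x\<close> makes the total error independent of the number of
  pieces.\<close>

lemma osc_near_int_integral_bound:
  fixes g g' f f' :: "real \<Rightarrow> real"
  assumes "a \<le> b" and meas: "g \<in> borel_measurable borel" "f \<in> borel_measurable borel"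
    and "\<And>x. x \<in> {a..b} \<Longrightarrow> (g has_real_derivative g' x) (at x)" "mono_on {a..b} g'"
    and "\<And>x. x \<in> {a..b} \<Longrightarrow> (f has_real_derivative f' x) (at x)" "mono_on {a..b} f'" "f' a > 0"
    and K: "K > 0" and "\<And>x. x \<in> {a..b} \<Longrightarrow> K * f' x \<le> g' x"
    and \<epsilon>: "0 \<le> \<epsilon>" "\<epsilon> < 1/2"
  shows "\<bar>integral {a..b} (\<lambda>x. (near_int \<delta> (g x) - 2 * \<delta>) * near_int \<epsilon> (f x))\<bar> \<le> 3/2 * (1 / g' a + (b - a) / K)"
proof -
  note [measurable] = meas
  define H where "H x = (near_int \<delta> (g x) - 2 * \<delta>) * near_int \<epsilon> (f x)" for x
  have "\<bar>H x\<bar> \<le> 1" for x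
    using abs_near_int_minus_mean_le[of \<delta> "g x"] near_int_0_or_1[OF \<epsilon>, of "f x"] by (auto simp: H_def)
  then have H: "H integrable_on {u..v}" for u v
    by (rule bounded_borel_integrable_on[rotated]) (unfold H_def, measurable)
  \<comment> \<open>Induction on \<open>r\<close>, which bounds the number of unit increases of
    \<open>f\<close>. Pieces are removed from the left, so \<open>a\<close> varies while
    \<open>b\<close> stays fixed.\<close>
  have "\<bar>integral {a..b} H\<bar> \<le> 3/2 * (1 / g' a + (b - a) / K)" if "f b - f a \<le> real (Suc r)" for r
    using assms(1,4-8,10) that
  proof (induction r arbitrary: a)
    case 0
    have sm: "strict_mono_on {a..b} f" using strict_mono_on_of_deriv 0 by blast
    have "0 < K * f' a" using K 0 by simp
    also have "\<dots> \<le> g' a" using 0 by auto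
    finally have "g' a > 0" .
    then have "\<bar>integral {a..b} H\<bar> \<le> 3/2 * (1 / g' a)"
      unfolding H_def using 0 strict_mono_on_imp_mono_on[OF sm]
      by (intro osc_near_int_integral_short \<epsilon> meas) auto
    moreover have "0 \<le> (b - a) / K" using 0 K by simp
    ultimately show ?case by (simp only: distrib_left)
  next
    case (Suc r)
    have sm: "strict_mono_on {a..b} f" using strict_mono_on_of_deriv Suc.prems by blast
    have "0 < K * f' a" using K Suc.prems by simp
    also have "\<dots> \<le> g' a" using Suc.prems by auto
    finally have ga: "g' a > 0" .
    show ?case
    proof (cases "f b - f a \<le> 1")
      case True
      have "\<bar>integral {a..b} H\<bar> \<le> 3/2 * (1 / g' a)"
        unfolding H_def using Suc.prems strict_mono_on_imp_mono_on[OF sm] True ga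
        by (intro osc_near_int_integral_short \<epsilon> meas) auto
      moreover have "0 \<le> (b - a) / K" using Suc.prems K by simp
      ultimately show ?thesis by (simp only: distrib_left)
    next
      case False
      have "continuous_on {a..b} f"
        by (intro continuous_at_imp_continuous_on ballI DERIV_isCont[OF Suc.prems(4)]) auto
      \<comment> \<open>On a piece where \<open>f\<close> grows by exactly 1, convexity of \<open>f\<close> bounds the error at the right endpoint
        by the length of the piece, so the errors of successive pieces add up to \<open>(b - a) / K\<close>.\<close>
      then obtain c where c: "a \<le> c" "c \<le> b" "f c = f a + 1"
        using IVT'[of f a "f a + 1" b] False Suc.prems(1) by auto
      have ac: "a < c" using c by (cases "a = c") auto
      have f'c: "f' a \<le> f' c" using monotone_onD[OF Suc.prems(5), of a c] c by auto
      obtain z where z: "a < z" "z < c" "f c - f a = (c - a) * f' z"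
        using MVT2[OF ac, of f f'] Suc.prems(4) c by auto
      have "f' z \<le> f' c" using monotone_onD[OF Suc.prems(5), of z c] c z by auto
      then have "1 \<le> (c - a) * f' c" using z c ac by (metis add_diff_cancel_left' diff_gt_0_iff_gt mult_le_cancel_left_pos)
      then have "K \<le> K * ((c - a) * f' c)" using K by simp
      also have "\<dots> = (c - a) * (K * f' c)" by simp
      also have "\<dots> \<le> (c - a) * g' c" using Suc.prems(7)[of c] c ac by (intro mult_left_mono) auto
      finally have "K \<le> (c - a) * g' c" .
      moreover have "g' c > 0"
        using ga monotone_onD[OF Suc.prems(3), of a c] c by auto
      ultimately have step: "1 / g' c \<le> (c - a) / K"
        using K by (simp add: field_simps)
      have "\<bar>integral {a..c} H\<bar> \<le> 3/2 * (1 / g' a)"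
        unfolding H_def
      proof (rule osc_near_int_integral_short[OF _ meas(1)])
        show "mono_on {a..c} g'" using Suc.prems(3) c by (auto simp: mono_on_def)
        show "mono_on {a..c} f" using strict_mono_on_imp_mono_on[OF sm] c by (auto simp: mono_on_def)
      qed (use Suc.prems c ga \<epsilon> in auto)
      moreover have "\<bar>integral {c..b} H\<bar> \<le> 3/2 * (1 / g' c + (b - c) / K)"
      proof (rule Suc.IH)
        show "mono_on {c..b} g'" using Suc.prems(3) c by (auto simp: mono_on_def)
        show "mono_on {c..b} f'" using Suc.prems(5) c by (auto simp: mono_on_def)
      qed (use Suc.prems c f'c in auto)
      moreover have "integral {a..b} H = integral {a..c} H + integral {c..b} H"
        using c by (intro Henstock_Kurzweil_Integration.integral_combine[symmetric] H) auto
      moreover have "3/2 * (1 / g' c + (b - c) / K) \<le> 3/2 * ((c - a) / K + (b - c) / K)"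
        using step by (intro mult_left_mono add_right_mono) auto
      moreover have "(c - a) / K + (b - c) / K = (b - a) / K" by (simp add: diff_divide_distrib)
      ultimately show ?thesis by (simp add: distrib_left)
    qed
  qed
  moreover obtain r where "f b - f a \<le> real (Suc r)"
    by (metis order.trans less_imp_le of_nat_le_iff le_SucI order_refl real_arch_simple)
  ultimately show ?thesis unfolding H_def by blast
qed

section \<open>Bounded Borel functions\<close>

text \<open>This class is closed under sums and products and consists of functions integrable on
  every compact interval, which settles the side conditions when squares of sums are expanded under
  the integral.\<close>

definition bounded_borel :: "(real \<Rightarrow> real) \<Rightarrow> bool" where
  "bounded_borel f \<longleftrightarrow> f \<in> borel_measurable borel \<and> (\<exists>C. \<forall>x. \<bar>f x\<bar> \<le> C)"

lemma bounded_borel_integrable: "bounded_borel f \<Longrightarrow> f integrable_on {a..b}"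
  unfolding bounded_borel_def using bounded_borel_integrable_on by blast

lemma bounded_borel_const: "bounded_borel (\<lambda>_. c)"
  by (auto simp: bounded_borel_def)

lemma bounded_borel_add:
  assumes "bounded_borel f" "bounded_borel g"
  shows "bounded_borel (\<lambda>x. f x + g x)"
proof -
  obtain C D where "\<forall>x. \<bar>f x\<bar> \<le> C" "\<forall>x. \<bar>g x\<bar> \<le> D" using assms by (auto simp: bounded_borel_def)
  then have "\<forall>x. \<bar>f x + g x\<bar> \<le> C + D" by (meson abs_triangle_ineq add_mono order_trans)
  then show ?thesis using assms by (auto simp: bounded_borel_def)
qed

lemma bounded_borel_mult:
  assumes "bounded_borel f" "bounded_borel g"
  shows "bounded_borel (\<lambda>x. f x * g x)"
proof -
  obtain C D where "\<forall>x. \<bar>f x\<bar> \<le> C" "\<forall>x. \<bar>g x\<bar> \<le> D" using assms by (auto simp: bounded_borel_def)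
  then have "\<forall>x. \<bar>f x * g x\<bar> \<le> C * D"
    unfolding abs_mult by (meson abs_ge_zero mult_mono order_trans)
  then show ?thesis using assms by (auto simp: bounded_borel_def)
qed

lemma bounded_borel_diff:
  assumes "bounded_borel f" "bounded_borel g"
  shows "bounded_borel (\<lambda>x. f x - g x)"
  using bounded_borel_add[OF assms(1) bounded_borel_mult[OF bounded_borel_const[of "-1"] assms(2)]] by simp

lemma bounded_borel_sum:
  "(\<And>i. i \<in> I \<Longrightarrow> bounded_borel (f i)) \<Longrightarrow> bounded_borel (\<lambda>x. \<Sum>i\<in>I. f i x)"
  by (induction I rule: infinite_finite_induct) (auto intro: bounded_borel_add bounded_borel_const)

lemma bounded_borel_power:
  "bounded_borel f \<Longrightarrow> bounded_borel (\<lambda>x. f x ^ k)"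
  by (induction k) (auto intro: bounded_borel_mult bounded_borel_const)

lemma bounded_borel_near_int:
  assumes "f \<in> borel_measurable borel"
  shows "bounded_borel (\<lambda>x. near_int \<delta> (f x))"
proof -
  note [measurable] = assms
  have "\<bar>near_int \<delta> (f x)\<bar> \<le> 1 + \<bar>2 * \<delta>\<bar>" for x
    using abs_near_int_minus_mean_le[of \<delta> "f x"] by linarith
  then show ?thesis by (auto simp: bounded_borel_def)
qed

lemmas bounded_borel_intros =
  bounded_borel_const bounded_borel_add bounded_borel_mult bounded_borel_diff bounded_borel_sum
  bounded_borel_power bounded_borel_near_int

text \<open>If \<open>t\<close> and \<open>t'\<close> are both close to integers, then so is
  \<open>t' - t\<close>, with twice the radius. For two differences with the same larger index this
  eliminates the common term; keeping the factor \<open>near_int \<delta> t\<close> retains its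
  oscillation.\<close>

lemma near_int_mult_le:
  assumes "0 \<le> \<delta>" "\<delta> < 1/4"
  shows "near_int \<delta> t * near_int \<delta> t' \<le> near_int \<delta> t * near_int (2 * \<delta>) (t' - t)"
proof -
  have "near_int (2 * \<delta>) (t' - t) = 1" if "near_int \<delta> t = 1" "near_int \<delta> t' = 1"
  proof -
    have "\<lfloor>t + \<delta>\<rfloor> = \<lfloor>t - \<delta>\<rfloor> + 1" "\<lfloor>t' + \<delta>\<rfloor> = \<lfloor>t' - \<delta>\<rfloor> + 1"
      using that by (auto simp: near_int_def)
    then have "t - \<delta> < of_int \<lfloor>t + \<delta>\<rfloor>" "t' - \<delta> < of_int \<lfloor>t' + \<delta>\<rfloor>"
      by linarith+
    then have "\<lfloor>t' + \<delta>\<rfloor> - \<lfloor>t + \<delta>\<rfloor> \<le> \<lfloor>t' - t + 2 * \<delta>\<rfloor>"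
      "\<lfloor>t' - t - 2 * \<delta>\<rfloor> < \<lfloor>t' + \<delta>\<rfloor> - \<lfloor>t + \<delta>\<rfloor>"
      unfolding le_floor_iff floor_less_iff of_int_diff
      using of_int_floor_le[of "t + \<delta>"] of_int_floor_le[of "t' + \<delta>"] by linarith+
    then have "\<lfloor>t' - t + 2 * \<delta>\<rfloor> \<noteq> \<lfloor>t' - t - 2 * \<delta>\<rfloor>"
      by linarith
    then have "near_int (2 * \<delta>) (t' - t) \<noteq> 0" by (simp add: near_int_def)
    then show ?thesis using near_int_0_or_1[of "2 * \<delta>" "t' - t"] assms by auto
  qed
  then show ?thesis
    using near_int_0_or_1[of \<delta> t] near_int_0_or_1[of \<delta> t'] near_int_0_or_1[of "2*\<delta>" "t' - t"] assms by auto
qed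

subsection \<open>Variance of the number of close pairs\<close>

text \<open>\<open>x n \<alpha>\<close> is the n-th term at parameter \<open>\<alpha>\<close> and
  \<open>x'\<close> its derivative in \<open>\<alpha>\<close>. The single quantity
  \<open>K n\<close> measures both the size of the derivative of a difference with larger index
  \<open>n\<close> and its dominance over differences with a smaller one. The weight
  \<open>n ^ 3\<close> in the sum bounds the number of pairs of differences whose larger indices are
  \<open>n\<close> and some \<open>n' < n\<close>.\<close>

locale lacunary_family =
  fixes x x' :: "nat \<Rightarrow> real \<Rightarrow> real" and A B \<kappa> :: real and K :: "nat \<Rightarrow> real"
  assumes AB: "A \<le> B"
    and der: "(x n has_real_derivative x' n \<alpha>) (at \<alpha>)"
    and mono: "1 \<le> m \<Longrightarrow> m < n \<Longrightarrow> mono_on {A..B} (\<lambda>\<alpha>. x' n \<alpha> - x' m \<alpha>)"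
    and K_pos: "K n > 0"
    and large: "1 \<le> m \<Longrightarrow> m < n \<Longrightarrow> \<alpha> \<in> {A..B} \<Longrightarrow> K n \<le> x' n \<alpha> - x' m \<alpha>"
    and ratio: "1 \<le> m \<Longrightarrow> m < n \<Longrightarrow> 1 \<le> m' \<Longrightarrow> m' < n' \<Longrightarrow> n' < n \<Longrightarrow> \<alpha> \<in> {A..B} \<Longrightarrow>
        K n * (x' n' \<alpha> - x' m' \<alpha>) \<le> x' n \<alpha> - x' m \<alpha>"
    and \<kappa>: "(\<Sum>n=1..N. real n ^ 3 / K n) \<le> \<kappa>"
begin

definition osc :: "real \<Rightarrow> nat \<Rightarrow> nat \<Rightarrow> real \<Rightarrow> real" where
  "osc \<delta> m n \<alpha> = near_int \<delta> (x n \<alpha> - x m \<alpha>) - 2 * \<delta>"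

lemma borel_x [measurable]: "x n \<in> borel_measurable borel"
  using der by (intro borel_measurable_continuous_onI continuous_at_imp_continuous_on ballI)
    (blast intro: DERIV_isCont)

lemma bounded_borel_osc: "bounded_borel (osc \<delta> m n)"
  unfolding osc_def[abs_def] by (intro bounded_borel_intros) measurable

lemma der_diff: "((\<lambda>\<alpha>. x n \<alpha> - x m \<alpha>) has_real_derivative x' n \<alpha> - x' m \<alpha>) (at \<alpha>)"
  by (intro derivative_intros der)

lemma inverse_deriv_le:
  assumes "1 \<le> m" "m < n"
  shows "0 < x' n A - x' m A" and "1 / (x' n A - x' m A) \<le> 1 / K n"
proof -
  have "K n \<le> x' n A - x' m A" using large[OF assms] AB by auto
  then show "0 < x' n A - x' m A" "1 / (x' n A - x' m A) \<le> 1 / K n"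
    using K_pos[of n] by (auto intro!: divide_left_mono)
qed

lemma integral_osc:
  assumes "1 \<le> m" "m < n"
  shows "\<bar>integral {A..B} (osc \<delta> m n)\<bar> \<le> 1 / (2 * K n)"
proof -
  have "\<bar>integral {A..B} (osc \<delta> m n)\<bar> \<le> 1 / (2 * (x' n A - x' m A))"
    unfolding osc_def
    by (rule osc_integral_bound[OF AB _ der_diff mono[OF assms] inverse_deriv_le(1)[OF assms]]) measurable
  also have "\<dots> = 1/2 * (1 / (x' n A - x' m A))" by (simp add: divide_simps)
  also have "\<dots> \<le> 1/2 * (1 / K n)" using inverse_deriv_le(2)[OF assms] by (intro mult_left_mono) auto
  finally show ?thesis by simp
qed

text \<open>The radius \<open>\<epsilon>\<close> is independent of \<open>\<delta>\<close>: it is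
  taken as \<open>\<delta>\<close> for different larger indices, and as \<open>2 * \<delta>\<close>
  after the reduction for equal ones.\<close>

lemma integral_osc_near_int:
  assumes mn: "1 \<le> m" "m < n" and mn': "1 \<le> m'" "m' < n'" "n' < n" and \<epsilon>: "0 \<le> \<epsilon>" "\<epsilon> < 1/2"
  shows "\<bar>integral {A..B} (\<lambda>\<alpha>. osc \<delta> m n \<alpha> * near_int \<epsilon> (x n' \<alpha> - x m' \<alpha>))\<bar> \<le> 3/2 * ((1 + B - A) / K n)"
proof -
  have "\<bar>integral {A..B} (\<lambda>\<alpha>. osc \<delta> m n \<alpha> * near_int \<epsilon> (x n' \<alpha> - x m' \<alpha>))\<bar>
      \<le> 3/2 * (1 / (x' n A - x' m A) + (B - A) / K n)"
    unfolding osc_def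
    by (rule osc_near_int_integral_bound[OF AB _ _ der_diff mono[OF mn] der_diff mono[OF mn'(1,2)]
          inverse_deriv_le(1)[OF mn'(1,2)] K_pos ratio[OF mn mn'] \<epsilon>]) measurable
  also have "\<dots> \<le> 3/2 * (1 / K n + (B - A) / K n)"
    using inverse_deriv_le(2)[OF mn] by (intro mult_left_mono add_right_mono) auto
  also have "\<dots> = 3/2 * ((1 + B - A) / K n)" by (simp add: add_divide_distrib diff_divide_distrib)
  finally show ?thesis .
qed

text \<open>Only the slower factor is expanded: its indicator contributes 3/2 and its mean
  \<open>2 * \<delta>\<close> contributes 1/2 of \<open>(1 + B - A) / K n\<close>.\<close>

lemma integral_osc_osc:
  assumes mn: "1 \<le> m" "m < n" and mn': "1 \<le> m'" "m' < n'" "n' < n" and \<delta>: "0 \<le> \<delta>" "\<delta> < 1/2"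
  shows "integral {A..B} (\<lambda>\<alpha>. osc \<delta> m n \<alpha> * osc \<delta> m' n' \<alpha>) \<le> 2 * (1 + B - A) / K n"
proof -
  let ?a = "\<lambda>\<alpha>. near_int \<delta> (x n' \<alpha> - x m' \<alpha>)"
  have bb: "bounded_borel (\<lambda>\<alpha>. osc \<delta> m n \<alpha> * ?a \<alpha>)" "bounded_borel (\<lambda>\<alpha>. 2 * \<delta> * osc \<delta> m n \<alpha>)"
    by (intro bounded_borel_intros bounded_borel_osc; measurable)+
  have "integral {A..B} (\<lambda>\<alpha>. osc \<delta> m n \<alpha> * osc \<delta> m' n' \<alpha>) =
     integral {A..B} (\<lambda>\<alpha>. osc \<delta> m n \<alpha> * ?a \<alpha> - 2 * \<delta> * osc \<delta> m n \<alpha>)"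
    by (intro integral_cong) (simp add: osc_def algebra_simps)
  also have "\<dots> = integral {A..B} (\<lambda>\<alpha>. osc \<delta> m n \<alpha> * ?a \<alpha>) - 2 * \<delta> * integral {A..B} (osc \<delta> m n)"
    by (subst integral_diff[OF bb[THEN bounded_borel_integrable]]) simp
  finally have eq: "integral {A..B} (\<lambda>\<alpha>. osc \<delta> m n \<alpha> * osc \<delta> m' n' \<alpha>) =
      integral {A..B} (\<lambda>\<alpha>. osc \<delta> m n \<alpha> * ?a \<alpha>) - 2 * \<delta> * integral {A..B} (osc \<delta> m n)" .
  have "\<bar>2 * \<delta> * integral {A..B} (osc \<delta> m n)\<bar> \<le> 1 * (1 / (2 * K n))"
    unfolding abs_mult[of "2 * \<delta>"] using \<delta> integral_osc[OF mn] by (intro mult_mono) auto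
  also have "\<dots> \<le> 1/2 * ((1 + B - A) / K n)"
    using AB K_pos[of n] by (simp add: field_simps)
  finally have small: "\<bar>2 * \<delta> * integral {A..B} (osc \<delta> m n)\<bar> \<le> 1/2 * ((1 + B - A) / K n)" .
  have diff_le: "u - v \<le> p + q" if "\<bar>u\<bar> \<le> p" "\<bar>v\<bar> \<le> q" for u v p q :: real
    using that by linarith
  have "integral {A..B} (\<lambda>\<alpha>. osc \<delta> m n \<alpha> * osc \<delta> m' n' \<alpha>) \<le>
      3/2 * ((1 + B - A) / K n) + 1/2 * ((1 + B - A) / K n)"
    unfolding eq using integral_osc_near_int[OF mn mn' \<delta>, of \<delta>] small by (rule diff_le)
  then show ?thesis by (simp add: add_divide_distrib diff_divide_distrib)
qed

lemma integral_near_int: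
  assumes "1 \<le> m" "m < n"
  shows "integral {A..B} (\<lambda>\<alpha>. near_int \<delta> (x n \<alpha> - x m \<alpha>)) \<le> 2 * \<delta> * (B - A) + 1 / (2 * K n)"
proof -
  have "integral {A..B} (\<lambda>\<alpha>. near_int \<delta> (x n \<alpha> - x m \<alpha>)) = integral {A..B} (\<lambda>\<alpha>. osc \<delta> m n \<alpha> + 2 * \<delta>)"
    by (simp add: osc_def)
  also have "\<dots> = integral {A..B} (osc \<delta> m n) + 2 * \<delta> * (B - A)"
    using AB bounded_borel_osc by (subst integral_add) (auto intro!: bounded_borel_integrable bounded_borel_const)
  finally show ?thesis using integral_osc[OF assms, of \<delta>] by linarith
qed

text \<open>Both factors oscillate at the rate of \<open>x n\<close>, so the derivative ratio gives
  no independence. The product of indicators is instead bounded through closeness of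
  \<open>x m\<close> to \<open>x m'\<close>, a pair with larger index \<open>m < n\<close>, whose
  correlation with \<open>osc \<delta> m n\<close> is small and whose measure is of order
  \<open>\<delta>\<close> plus an error.\<close>

lemma integral_osc_same_top:
  assumes mn: "1 \<le> m'" "m' < m" "m < n" and \<delta>: "0 \<le> \<delta>" "\<delta> < 1/4"
  shows "integral {A..B} (\<lambda>\<alpha>. osc \<delta> m n \<alpha> * osc \<delta> m' n \<alpha>) \<le>
    3/2 * ((1 + B - A) / K n) + 12 * \<delta>\<^sup>2 * (B - A) + \<delta> / K m"
proof -
  let ?b = "\<lambda>\<alpha>. near_int (2 * \<delta>) (x m \<alpha> - x m' \<alpha>)"
  have bb: "bounded_borel (\<lambda>\<alpha>. osc \<delta> m n \<alpha> * ?b \<alpha>)" "bounded_borel (\<lambda>\<alpha>. 2 * \<delta> * ?b \<alpha> + 4 * \<delta>\<^sup>2)"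
      "bounded_borel (\<lambda>\<alpha>. 2 * \<delta> * ?b \<alpha>)" "bounded_borel (\<lambda>\<alpha>. osc \<delta> m n \<alpha> * osc \<delta> m' n \<alpha>)"
    by (intro bounded_borel_intros bounded_borel_osc; measurable)+
  \<comment> \<open>The mixed terms of the expanded product are nonpositive and are dropped. Then
    the remaining indicator is written as \<open>osc \<delta> m n\<close> plus its mean
    \<open>2 * \<delta>\<close>.\<close>
  have le: "osc \<delta> m n \<alpha> * osc \<delta> m' n \<alpha> \<le> osc \<delta> m n \<alpha> * ?b \<alpha> + (2 * \<delta> * ?b \<alpha> + 4 * \<delta>\<^sup>2)" for \<alpha>
  proof -
    let ?t = "x n \<alpha> - x m \<alpha>" and ?t' = "x n \<alpha> - x m' \<alpha>"
    have "0 \<le> 2 * \<delta> * (near_int \<delta> ?t + near_int \<delta> ?t')"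
      using near_int_0_or_1[of \<delta> ?t] near_int_0_or_1[of \<delta> ?t'] \<delta> by (intro mult_nonneg_nonneg) auto
    then have "osc \<delta> m n \<alpha> * osc \<delta> m' n \<alpha> \<le> near_int \<delta> ?t * near_int \<delta> ?t' + 4 * \<delta>\<^sup>2"
      by (simp add: osc_def algebra_simps power2_eq_square)
    also have "\<dots> \<le> near_int \<delta> ?t * ?b \<alpha> + 4 * \<delta>\<^sup>2"
      using near_int_mult_le[OF \<delta>, of ?t ?t'] by simp
    finally show ?thesis by (simp add: osc_def algebra_simps)
  qed
  have "integral {A..B} (\<lambda>\<alpha>. osc \<delta> m n \<alpha> * osc \<delta> m' n \<alpha>) \<le>
     integral {A..B} (\<lambda>\<alpha>. osc \<delta> m n \<alpha> * ?b \<alpha> + (2 * \<delta> * ?b \<alpha> + 4 * \<delta>\<^sup>2))"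
    using le by (intro integral_le bounded_borel_integrable bounded_borel_add bb) auto
  also have "\<dots> = integral {A..B} (\<lambda>\<alpha>. osc \<delta> m n \<alpha> * ?b \<alpha>) +
      (2 * \<delta> * integral {A..B} ?b + 4 * \<delta>\<^sup>2 * (B - A))"
    using AB by (simp add: integral_add bb[THEN bounded_borel_integrable] bounded_borel_integrable[OF bounded_borel_const])
  also have "\<dots> \<le> 3/2 * ((1 + B - A) / K n) + (2 * \<delta> * (2 * (2 * \<delta>) * (B - A) + 1 / (2 * K m)) + 4 * \<delta>\<^sup>2 * (B - A))"
  proof (intro add_mono mult_left_mono order_refl)
    show "integral {A..B} (\<lambda>\<alpha>. osc \<delta> m n \<alpha> * ?b \<alpha>) \<le> 3/2 * ((1 + B - A) / K n)"
      using integral_osc_near_int[of m n m' m "2 * \<delta>" \<delta>] mn \<delta> by auto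
    show "integral {A..B} ?b \<le> 2 * (2 * \<delta>) * (B - A) + 1 / (2 * K m)"
      using mn by (intro integral_near_int) auto
  qed (use \<delta> in auto)
  also have "\<dots> = 3/2 * ((1 + B - A) / K n) + 12 * \<delta>\<^sup>2 * (B - A) + \<delta> / K m"
    using K_pos[of m] by (simp add: field_simps power2_eq_square)
  finally show ?thesis .
qed

lemma integral_osc_square:
  assumes mn: "1 \<le> m" "m < n" and \<delta>: "0 \<le> \<delta>" "\<delta> < 1/4"
  shows "integral {A..B} (\<lambda>\<alpha>. (osc \<delta> m n \<alpha>)\<^sup>2) \<le> 4 * \<delta> * (B - A) + 1 / (2 * K n)"
proof -
  let ?b = "\<lambda>\<alpha>. near_int \<delta> (x n \<alpha> - x m \<alpha>)"
  have bb: "bounded_borel ?b" "bounded_borel (\<lambda>\<alpha>. (osc \<delta> m n \<alpha>)\<^sup>2)"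
    by (intro bounded_borel_intros bounded_borel_osc; measurable)+
  have le: "(osc \<delta> m n \<alpha>)\<^sup>2 \<le> ?b \<alpha> + 2 * \<delta>" for \<alpha>
  proof -
    have "\<delta> * \<delta> \<le> \<delta> * (1/2)" using \<delta> by (intro mult_left_mono) auto
    then show ?thesis
      using near_int_0_or_1[of \<delta> "x n \<alpha> - x m \<alpha>"] \<delta> by (auto simp: osc_def power2_eq_square algebra_simps)
  qed
  have "integral {A..B} (\<lambda>\<alpha>. (osc \<delta> m n \<alpha>)\<^sup>2) \<le> integral {A..B} (\<lambda>\<alpha>. ?b \<alpha> + 2 * \<delta>)"
    using le by (intro integral_le bounded_borel_integrable bounded_borel_add bb bounded_borel_const) auto
  also have "\<dots> = integral {A..B} ?b + 2 * \<delta> * (B - A)"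
    using AB by (simp add: integral_add bb[THEN bounded_borel_integrable] bounded_borel_integrable[OF bounded_borel_const])
  finally show ?thesis using integral_near_int[OF mn, of \<delta>] by simp
qed

section \<open>Second moments of rows and of their sum\<close>

text \<open>The bound \<open>k\<close> is kept apart from the larger index \<open>n\<close> so that
  a square can be expanded one smaller index at a time; the full row is the case
  \<open>k = n\<close>.\<close>

definition row :: "real \<Rightarrow> nat \<Rightarrow> nat \<Rightarrow> real \<Rightarrow> real" where
  "row \<delta> n k \<alpha> = (\<Sum>m=1..<k. osc \<delta> m n \<alpha>)"

lemma bounded_borel_row: "bounded_borel (row \<delta> n k)"
  unfolding row_def[abs_def] by (intro bounded_borel_sum bounded_borel_osc)

lemma integral_square_sum:
  assumes "bounded_borel f" "bounded_borel g"
  shows "integral {A..B} (\<lambda>\<alpha>. (f \<alpha> + g \<alpha>)\<^sup>2) =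
    integral {A..B} (\<lambda>\<alpha>. (f \<alpha>)\<^sup>2) + integral {A..B} (\<lambda>\<alpha>. (g \<alpha>)\<^sup>2) + 2 * integral {A..B} (\<lambda>\<alpha>. g \<alpha> * f \<alpha>)"
proof -
  have bb: "bounded_borel (\<lambda>\<alpha>. (f \<alpha>)\<^sup>2)" "bounded_borel (\<lambda>\<alpha>. (g \<alpha>)\<^sup>2)" "bounded_borel (\<lambda>\<alpha>. 2 * (g \<alpha> * f \<alpha>))"
      "bounded_borel (\<lambda>\<alpha>. (f \<alpha>)\<^sup>2 + (g \<alpha>)\<^sup>2)"
    by (intro bounded_borel_intros assms)+
  have "integral {A..B} (\<lambda>\<alpha>. (f \<alpha> + g \<alpha>)\<^sup>2) = integral {A..B} (\<lambda>\<alpha>. ((f \<alpha>)\<^sup>2 + (g \<alpha>)\<^sup>2) + 2 * (g \<alpha> * f \<alpha>))"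
    by (intro integral_cong) (simp add: power2_eq_square algebra_simps)
  also have "\<dots> = integral {A..B} (\<lambda>\<alpha>. (f \<alpha>)\<^sup>2) + integral {A..B} (\<lambda>\<alpha>. (g \<alpha>)\<^sup>2) + 2 * integral {A..B} (\<lambda>\<alpha>. g \<alpha> * f \<alpha>)"
    by (subst integral_add, (rule bounded_borel_integrable bb)+)
      (subst integral_add, (rule bounded_borel_integrable bb)+, simp)
  finally show ?thesis .
qed

lemma integral_row_square_partial:
  assumes \<delta>: "0 \<le> \<delta>" "\<delta> < 1/4" and "k \<le> n"
  shows "integral {A..B} (\<lambda>\<alpha>. (row \<delta> n k \<alpha>)\<^sup>2) \<le>
    (\<Sum>m=1..<k. 4 * \<delta> * (B - A) + 1 / (2 * K n) +
       2 * (real m * (3/2 * ((1 + B - A) / K n) + 12 * \<delta>\<^sup>2 * (B - A) + \<delta> / K m)))"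
  using \<open>k \<le> n\<close>
proof (induction k)
  case 0
  then show ?case by (simp add: row_def)
next
  case (Suc k)
  show ?case
  proof (cases "k = 0")
    case True
    then show ?thesis by (simp add: row_def)
  next
    case False
    then have k: "1 \<le> k" "k < n" using Suc.prems by auto
    let ?D = "3/2 * ((1 + B - A) / K n) + 12 * \<delta>\<^sup>2 * (B - A) + \<delta> / K k"
    have row_Suc: "row \<delta> n (Suc k) = (\<lambda>\<alpha>. row \<delta> n k \<alpha> + osc \<delta> k n \<alpha>)"
      using k by (auto simp: row_def fun_eq_iff)
    have "integral {A..B} (\<lambda>\<alpha>. osc \<delta> k n \<alpha> * row \<delta> n k \<alpha>) =
        (\<Sum>m=1..<k. integral {A..B} (\<lambda>\<alpha>. osc \<delta> k n \<alpha> * osc \<delta> m n \<alpha>))"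
      unfolding row_def sum_distrib_left
      by (intro integral_sum) (auto intro!: bounded_borel_integrable bounded_borel_mult bounded_borel_osc)
    also have "\<dots> \<le> (\<Sum>m=1..<k. ?D)"
      using k \<delta> by (intro sum_mono integral_osc_same_top) auto
    also have "\<dots> = real (k - 1) * ?D" by simp
    also have "\<dots> \<le> real k * ?D"
      using K_pos[of k] K_pos[of n] \<delta> AB by (intro mult_right_mono) (auto intro!: add_nonneg_nonneg)
    finally have cross: "integral {A..B} (\<lambda>\<alpha>. osc \<delta> k n \<alpha> * row \<delta> n k \<alpha>) \<le> real k * ?D" .
    have "integral {A..B} (\<lambda>\<alpha>. (row \<delta> n (Suc k) \<alpha>)\<^sup>2) =
        integral {A..B} (\<lambda>\<alpha>. (row \<delta> n k \<alpha>)\<^sup>2) + integral {A..B} (\<lambda>\<alpha>. (osc \<delta> k n \<alpha>)\<^sup>2) +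
        2 * integral {A..B} (\<lambda>\<alpha>. osc \<delta> k n \<alpha> * row \<delta> n k \<alpha>)"
      unfolding row_Suc by (rule integral_square_sum[OF bounded_borel_row bounded_borel_osc])
    then show ?thesis
      using cross Suc.IH integral_osc_square[OF k \<delta>] k by simp
  qed
qed

text \<open>For \<open>\<delta>\<close> of order \<open>1 / N\<close> and \<open>n \<le> N\<close>
  every term except the last is bounded, and the last is summable over \<open>n\<close>.\<close>

lemma integral_row_square:
  assumes \<delta>: "0 \<le> \<delta>" "\<delta> < 1/4"
  shows "integral {A..B} (\<lambda>\<alpha>. (row \<delta> n n \<alpha>)\<^sup>2) \<le>
    4 * \<delta> * (B - A) * n + 24 * \<delta>\<^sup>2 * (B - A) * (real n)\<^sup>2 + 2 * \<delta> * \<kappa> + 4 * (1 + B - A) * (real n ^ 3 / K n)"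
proof -
  let ?c = "1 + B - A"
  let ?E = "4 * \<delta> * (B - A) + 1 / (2 * K n) + real n * (3 * (?c / K n) + 24 * \<delta>\<^sup>2 * (B - A))"
  have E0: "0 \<le> ?E"
    using K_pos[of n] \<delta> AB by (auto intro!: add_nonneg_nonneg mult_nonneg_nonneg)
  have "integral {A..B} (\<lambda>\<alpha>. (row \<delta> n n \<alpha>)\<^sup>2) \<le> (\<Sum>m=1..<n. ?E + 2 * \<delta> * (real m ^ 3 / K m))"
  proof (rule order_trans[OF integral_row_square_partial[OF \<delta> order_refl] sum_mono])
    fix m assume m: "m \<in> {1..<n}"
    have "real m * (3 * (?c / K n) + 24 * \<delta>\<^sup>2 * (B - A)) \<le> real n * (3 * (?c / K n) + 24 * \<delta>\<^sup>2 * (B - A))"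
      using m K_pos[of n] \<delta> AB by (intro mult_right_mono) (auto intro!: add_nonneg_nonneg mult_nonneg_nonneg)
    \<comment> \<open>Weakened to the cubic weight so that the bound \<open>\<kappa>\<close> applies
      here as well.\<close>
    moreover have "2 * \<delta> * (real m / K m) \<le> 2 * \<delta> * (real m ^ 3 / K m)"
      using m K_pos[of m] \<delta> by (intro mult_left_mono divide_right_mono self_le_power) auto
    moreover have "2 * (real m * (3/2 * (?c / K n) + 12 * \<delta>\<^sup>2 * (B - A) + \<delta> / K m)) =
        real m * (3 * (?c / K n) + 24 * \<delta>\<^sup>2 * (B - A)) + 2 * \<delta> * (real m / K m)"
    proof -
      have "2 * (M * (3/2 * u + 12 * d * l + \<delta> / k)) = M * (3 * u + 24 * d * l) + 2 * \<delta> * (M / k)"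
        for M u d l k :: real by (simp add: algebra_simps)
      then show ?thesis .
    qed
    ultimately show "4 * \<delta> * (B - A) + 1 / (2 * K n) +
        2 * (real m * (3/2 * (?c / K n) + 12 * \<delta>\<^sup>2 * (B - A) + \<delta> / K m)) \<le> ?E + 2 * \<delta> * (real m ^ 3 / K m)"
      by (simp only:)
  qed
  also have "\<dots> = real (n - 1) * ?E + 2 * \<delta> * (\<Sum>m=1..<n. real m ^ 3 / K m)"
    by (simp add: sum.distrib sum_distrib_left)
  also have "\<dots> \<le> real n * ?E + 2 * \<delta> * \<kappa>"
  proof (intro add_mono mult_right_mono mult_left_mono)
    have "(\<Sum>m=1..<n. real m ^ 3 / K m) \<le> (\<Sum>m=1..n. real m ^ 3 / K m)"
      using K_pos by (intro sum_mono2) (auto simp: less_imp_le)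
    then show "(\<Sum>m=1..<n. real m ^ 3 / K m) \<le> \<kappa>" using \<kappa>[of n] by linarith
  qed (use E0 \<delta> in auto)
  also have "real n * ?E = 4 * \<delta> * (B - A) * n + 24 * \<delta>\<^sup>2 * (B - A) * (real n)\<^sup>2 +
      (real n / 2 + 3 * ?c * (real n)\<^sup>2) / K n"
    using K_pos[of n] by (simp add: field_simps power2_eq_square)
  also have "(real n / 2 + 3 * ?c * (real n)\<^sup>2) / K n \<le> 4 * ?c * real n ^ 3 / K n"
  proof (rule divide_right_mono)
    have "real n \<le> real n ^ 3" "(real n)\<^sup>2 \<le> real n ^ 3"
      by (cases "n = 0"; auto intro!: self_le_power power_increasing)+
    moreover have "1 * real n ^ 3 \<le> ?c * real n ^ 3" using AB by (intro mult_right_mono) auto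
    moreover have "?c * (real n)\<^sup>2 \<le> ?c * real n ^ 3" using AB calculation by (intro mult_left_mono) auto
    moreover have "real n \<ge> 0" by simp
    ultimately show "real n / 2 + 3 * ?c * (real n)\<^sup>2 \<le> 4 * ?c * real n ^ 3" by (simp only: mult.assoc)
  qed (use K_pos[of n] in auto)
  finally show ?thesis by simp
qed

text \<open>Deviation of the number of close unordered pairs among the first \<open>N\<close> terms
  from its expected value.\<close>

definition total :: "real \<Rightarrow> nat \<Rightarrow> real \<Rightarrow> real" where
  "total \<delta> N \<alpha> = (\<Sum>n=1..N. row \<delta> n n \<alpha>)"

lemma bounded_borel_total: "bounded_borel (total \<delta> N)"
  unfolding total_def[abs_def] by (intro bounded_borel_sum bounded_borel_row)

text \<open>After expansion there are at most \<open>n ^ 3\<close> triples of \<open>m\<close>,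
  \<open>m'\<close> and \<open>n'\<close>, all with \<open>n' < n\<close>, and each costs at most
  \<open>2 * (1 + B - A) / K n\<close>.\<close>

lemma integral_row_total:
  assumes \<delta>: "0 \<le> \<delta>" "\<delta> < 1/4" and "N < n"
  shows "integral {A..B} (\<lambda>\<alpha>. row \<delta> n n \<alpha> * total \<delta> N \<alpha>) \<le> 2 * (1 + B - A) * (real n ^ 3 / K n)"
proof -
  let ?D = "2 * (1 + B - A) / K n"
  have D: "?D \<ge> 0" using AB K_pos[of n] by simp
  have "integral {A..B} (\<lambda>\<alpha>. row \<delta> n n \<alpha> * total \<delta> N \<alpha>) =
      (\<Sum>n'=1..N. \<Sum>m'=1..<n'. \<Sum>m=1..<n. integral {A..B} (\<lambda>\<alpha>. osc \<delta> m n \<alpha> * osc \<delta> m' n' \<alpha>))"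
    unfolding row_def total_def sum_distrib_left sum_distrib_right
    by (subst integral_sum integral_sum[OF finite_atLeastAtMost] integral_sum[OF finite_atLeastLessThan];
        (auto intro!: bounded_borel_integrable bounded_borel_intros bounded_borel_osc)?)+
  also have "\<dots> \<le> (\<Sum>n'=1..N. \<Sum>m'=1..<n'. \<Sum>m=1..<n. ?D)"
    using assms by (intro sum_mono integral_osc_osc) auto
  also have "\<dots> = (\<Sum>n'=1..N. real (n' - 1) * (real (n - 1) * ?D))" by simp
  also have "\<dots> \<le> (\<Sum>n'=1..N. real n * (real n * ?D))"
    using assms D by (intro sum_mono mult_mono mult_nonneg_nonneg) auto
  also have "\<dots> = real N * (real n * (real n * ?D))" by simp
  also have "\<dots> \<le> real n * (real n * (real n * ?D))"
    using assms D by (intro mult_mono mult_nonneg_nonneg) auto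
  also have "\<dots> = 2 * (1 + B - A) * (real n ^ 3 / K n)" by (simp add: power3_eq_cube)
  finally show ?thesis .
qed

text \<open>Rows are added one at a time. The constant 8 collects 4 from the square of the new row
  and twice 2 from its product with the earlier ones; for \<open>\<delta> = s / N\<close> the whole
  bound is linear in \<open>N\<close>.\<close>

lemma integral_total_square:
  assumes \<delta>: "0 \<le> \<delta>" "\<delta> < 1/4"
  shows "integral {A..B} (\<lambda>\<alpha>. (total \<delta> N \<alpha>)\<^sup>2) \<le>
    N * (4 * \<delta> * (B - A) * N + 24 * \<delta>\<^sup>2 * (B - A) * (real N)\<^sup>2 + 2 * \<delta> * \<kappa>) + 8 * (1 + B - A) * \<kappa>"
proof -
  let ?D = "4 * \<delta> * (B - A) * N + 24 * \<delta>\<^sup>2 * (B - A) * (real N)\<^sup>2 + 2 * \<delta> * \<kappa>"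
  have "integral {A..B} (\<lambda>\<alpha>. (total \<delta> k \<alpha>)\<^sup>2) \<le> k * ?D + 8 * (1 + B - A) * (\<Sum>n=1..k. real n ^ 3 / K n)"
    if "k \<le> N" for k
    using that
  proof (induction k)
    case 0
    then show ?case by (simp add: total_def)
  next
    case (Suc k)
    let ?n = "Suc k"
    have eq: "total \<delta> (Suc k) = (\<lambda>\<alpha>. total \<delta> k \<alpha> + row \<delta> ?n ?n \<alpha>)"
      by (auto simp: total_def fun_eq_iff)
    have "integral {A..B} (\<lambda>\<alpha>. (row \<delta> ?n ?n \<alpha>)\<^sup>2) \<le>
      4 * \<delta> * (B - A) * ?n + 24 * \<delta>\<^sup>2 * (B - A) * (real ?n)\<^sup>2 + 2 * \<delta> * \<kappa> + 4 * (1 + B - A) * (real ?n ^ 3 / K ?n)"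
      by (rule integral_row_square[OF \<delta>])
    also have "\<dots> \<le> ?D + 4 * (1 + B - A) * (real ?n ^ 3 / K ?n)"
      using Suc.prems AB \<delta> by (intro add_right_mono add_mono mult_left_mono power_mono) auto
    finally have r: "integral {A..B} (\<lambda>\<alpha>. (row \<delta> ?n ?n \<alpha>)\<^sup>2) \<le> ?D + 4 * (1 + B - A) * (real ?n ^ 3 / K ?n)" .
    have "integral {A..B} (\<lambda>\<alpha>. (total \<delta> (Suc k) \<alpha>)\<^sup>2) =
        integral {A..B} (\<lambda>\<alpha>. (total \<delta> k \<alpha>)\<^sup>2) + integral {A..B} (\<lambda>\<alpha>. (row \<delta> ?n ?n \<alpha>)\<^sup>2) +
        2 * integral {A..B} (\<lambda>\<alpha>. row \<delta> ?n ?n \<alpha> * total \<delta> k \<alpha>)"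
      unfolding eq by (rule integral_square_sum[OF bounded_borel_total bounded_borel_row])
    also have "\<dots> \<le> (k * ?D + 8 * (1 + B - A) * (\<Sum>n=1..k. real n ^ 3 / K n)) +
        (?D + 4 * (1 + B - A) * (real ?n ^ 3 / K ?n)) + 2 * (2 * (1 + B - A) * (real ?n ^ 3 / K ?n))"
      using Suc.IH Suc.prems integral_row_total[OF \<delta>, of k ?n] r by (intro add_mono mult_left_mono) auto
    also have "\<dots> = real ?n * ?D + 8 * (1 + B - A) * ((\<Sum>n=1..k. real n ^ 3 / K n) + real ?n ^ 3 / K ?n)"
    proof -
      have *: "(a * D + 8 * c * s) + (D + 4 * c * q) + 2 * (2 * c * q) = (a + 1) * D + 8 * c * (s + q)"
        for a D c s q :: real by (simp add: algebra_simps)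
      show ?thesis unfolding * by simp
    qed
    also have "(\<Sum>n=1..k. real n ^ 3 / K n) + real ?n ^ 3 / K ?n = (\<Sum>n=1..?n. real n ^ 3 / K n)" by simp
    finally show ?case .
  qed
  from this[of N] have "integral {A..B} (\<lambda>\<alpha>. (total \<delta> N \<alpha>)\<^sup>2) \<le> N * ?D + 8 * (1 + B - A) * (\<Sum>n=1..N. real n ^ 3 / K n)"
    by simp
  also have "\<dots> \<le> N * ?D + 8 * (1 + B - A) * \<kappa>"
    using \<kappa>[of N] AB by (intro add_left_mono mult_left_mono) auto
  finally show ?thesis .
qed

end

subsection \<open>From squares to all indices\<close>

lemma near_int_le_closed:
  assumes "0 \<le> \<delta>" "\<delta> < 1/2"
  shows "near_int \<delta> t \<le> of_bool (dist_nearest_int t \<le> \<delta>)"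
proof (cases "near_int \<delta> t = 1")
  case True
  then have "\<lfloor>t + \<delta>\<rfloor> = \<lfloor>t - \<delta>\<rfloor> + 1" by (auto simp: near_int_def)
  then have "\<bar>t - of_int \<lfloor>t + \<delta>\<rfloor>\<bar> \<le> \<delta>" by linarith
  then show ?thesis
    using round_diff_minimal[of t "\<lfloor>t + \<delta>\<rfloor>"] True by (auto simp: dist_nearest_int_def dist_real_def)
qed (use near_int_0_or_1[OF assms, of t] in auto)

text \<open>An integer at distance exactly \<open>\<delta>\<close> may be missed by the half-open
  interval of radius \<open>\<delta>\<close>, but it lies inside the one of any larger radius
  \<open>\<delta>'\<close>.\<close>

lemma closed_le_near_int:
  assumes "0 \<le> \<delta>" "\<delta> < \<delta>'" "\<delta>' < 1/2"
  shows "of_bool (dist_nearest_int t \<le> \<delta>) \<le> near_int \<delta>' t"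
proof (cases "dist_nearest_int t \<le> \<delta>")
  case True
  then have "\<bar>t - of_int (round t)\<bar> \<le> \<delta>" by (simp add: dist_nearest_int_def dist_real_def)
  then have "round t \<le> \<lfloor>t + \<delta>'\<rfloor>" "\<lfloor>t - \<delta>'\<rfloor> < round t"
    unfolding le_floor_iff floor_less_iff using assms by linarith+
  then have "near_int \<delta>' t \<ge> 1" by (simp add: near_int_def)
  then show ?thesis by auto
qed (use near_int_0_or_1[of \<delta>' t] assms in auto)

lemma dist_nearest_int_minus: "dist_nearest_int (- t) = dist_nearest_int t"
proof -
  have "dist_nearest_int (- t) \<le> dist_nearest_int t" for t
    using round_diff_minimal[of "-t" "- round t"] by (auto simp: dist_nearest_int_def dist_real_def)
  from this[of t] this[of "-t"] show ?thesis by simp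
qed

section \<open>Counting close pairs\<close>

text \<open>Pairs are counted once, with \<open>m < n\<close>, so the limit to establish is
  \<open>s\<close> instead of \<open>2 * s\<close>. The half-open count is the one with controlled
  variance; the closed count below is the one in the definition of Poissonian pair
  correlations.\<close>

definition pair_count :: "(nat \<Rightarrow> real) \<Rightarrow> nat \<Rightarrow> real \<Rightarrow> real" where
  "pair_count x N \<delta> = (\<Sum>n=1..N. \<Sum>m=1..<n. near_int \<delta> (x n - x m))"

definition closed_pair_count :: "(nat \<Rightarrow> real) \<Rightarrow> nat \<Rightarrow> real \<Rightarrow> real" where
  "closed_pair_count x N \<delta> = (\<Sum>n=1..N. \<Sum>m=1..<n. of_bool (dist_nearest_int (x n - x m) \<le> \<delta>))"

text \<open>The distance to the nearest integer is even, so the ordered pairs split into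
  \<open>T\<close>, where the first index is the larger one, and the mirror image of
  \<open>T\<close>.\<close>

lemma card_close_pairs:
  "real (card {(m, n). m \<in> {1..N} \<and> n \<in> {1..N} \<and> m \<noteq> n \<and> dist_nearest_int (x n - x m) \<le> \<delta>})
   = 2 * closed_pair_count x N \<delta>"
proof -
  define T where "T = (SIGMA n:{1..N}. {m\<in>{1..<n}. dist_nearest_int (x n - x m) \<le> \<delta>})"
  have sym: "dist_nearest_int (x n - x m) = dist_nearest_int (x m - x n)" for m n
    using dist_nearest_int_minus[of "x n - x m"] by simp
  have "{(m, n). m \<in> {1..N} \<and> n \<in> {1..N} \<and> m \<noteq> n \<and> dist_nearest_int (x n - x m) \<le> \<delta>} = T \<union> prod.swap ` T"
    (is "?S = _")
  proof
    show "?S \<subseteq> T \<union> prod.swap ` T"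
    proof
      fix p assume p: "p \<in> ?S"
      obtain m n where mn: "p = (m, n)" by fastforce
      then have "m < n \<or> n < m" using p by auto
      then show "p \<in> T \<union> prod.swap ` T"
        using p mn sym[of m n] by (auto simp: T_def image_iff)
    qed
    show "T \<union> prod.swap ` T \<subseteq> ?S" using sym by (auto simp: T_def)
  qed
  moreover have "T \<inter> prod.swap ` T = {}" by (auto simp: T_def)
  moreover have fin: "finite T" by (auto simp: T_def)
  ultimately have "card ?S = card T + card (prod.swap ` T)"
    by (simp add: card_Un_disjoint)
  also have "card (prod.swap ` T) = card T" by (intro card_image) auto
  finally have "real (card ?S) = 2 * real (card T)" by simp
  also have "real (card T) = closed_pair_count x N \<delta>"
    unfolding T_def closed_pair_count_def
    by (subst card_SigmaI) (auto simp: sum.If_cases of_bool_def Int_def intro!: sum.cong arg_cong[where f=card])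
  finally show ?thesis .
qed

lemma closed_pair_count_mono:
  assumes "N \<le> N'" "\<delta> \<le> \<delta>'"
  shows "closed_pair_count x N \<delta> \<le> closed_pair_count x N' \<delta>'"
proof -
  have "closed_pair_count x N \<delta> \<le> closed_pair_count x N \<delta>'"
    unfolding closed_pair_count_def using assms by (intro sum_mono) auto
  also have "\<dots> \<le> closed_pair_count x N' \<delta>'"
    unfolding closed_pair_count_def using assms by (intro sum_mono2) (auto intro!: sum_nonneg)
  finally show ?thesis .
qed

lemma pair_count_le_closed:
  assumes "0 \<le> \<delta>" "\<delta> < 1/2"
  shows "pair_count x N \<delta> \<le> closed_pair_count x N \<delta>"
  unfolding pair_count_def closed_pair_count_def by (intro sum_mono near_int_le_closed assms)

lemma closed_le_pair_count:
  assumes "0 \<le> \<delta>" "\<delta> < \<delta>'" "\<delta>' < 1/2"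
  shows "closed_pair_count x N \<delta> \<le> pair_count x N \<delta>'"
  unfolding pair_count_def closed_pair_count_def by (intro sum_mono closed_le_near_int assms)

lemma filterlim_floor_sqrt: "filterlim floor_sqrt at_top at_top"
  unfolding filterlim_at_top
proof
  fix Z :: nat
  show "\<forall>\<^sub>F n in sequentially. Z \<le> floor_sqrt n"
    using eventually_ge_at_top[of "Z\<^sup>2"]
    by eventually_elim (use mono_floor_sqrt' in fastforce)
qed

text \<open>For \<open>N\<close> between consecutive squares the count is compared with the counts
  at these squares, for a radius parameter \<open>q\<close> slightly below or above
  \<open>s\<close>. The room between \<open>q\<close> and \<open>s\<close> absorbs the ratio of the
  squares, which tends to 1. Rational \<open>q\<close> suffice, which keeps the number of
  exceptional null sets countable.\<close>

lemma poissonian_of_squares: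
  assumes conv: "\<And>s. s \<in> \<rat> \<Longrightarrow> s > 0 \<Longrightarrow>
    (\<lambda>j. pair_count x (j\<^sup>2) (s / real (j\<^sup>2)) / real (j\<^sup>2)) \<longlonglongrightarrow> s"
  shows "poissonian_pair_correlations x"
  unfolding poissonian_pair_correlations_def card_close_pairs
proof (intro allI impI)
  fix s :: real assume s: "s > 0"
  let ?R = "\<lambda>N. closed_pair_count x N (s / real N) / real N"
  have "?R \<longlonglongrightarrow> s"
  proof (rule order_tendstoI)
    fix a assume "a < s"
    \<comment> \<open>The lower bound uses the square below \<open>N\<close>; the maximum with 0
      keeps \<open>q\<close> positive even if \<open>a\<close> is negative.\<close>
    then obtain q where q: "q \<in> \<rat>" "max a 0 < q" "q < s"
      using Rats_dense_in_real[of "max a 0" s] s by auto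
    let ?u = "\<lambda>j::nat. pair_count x (j\<^sup>2) (q / real (j\<^sup>2)) / real (j\<^sup>2) * (real (j\<^sup>2) / real ((j + 1)\<^sup>2))"
    have "(\<lambda>j::nat. real (j\<^sup>2) / real ((j + 1)\<^sup>2)) \<longlonglongrightarrow> 1" by real_asymp
    then have "?u \<longlonglongrightarrow> q * 1" using q by (intro tendsto_mult conv) auto
    then have "\<forall>\<^sub>F j in sequentially. a < ?u j" using q by (intro order_tendstoD) auto
    moreover have "\<forall>\<^sub>F j::nat in sequentially. q / s < real (j\<^sup>2) / real ((j + 1)\<^sup>2)"
      using q s by (intro order_tendstoD(1)[where y=1]) (real_asymp, simp)
    moreover have "\<forall>\<^sub>F j::nat in sequentially. q / real (j\<^sup>2) < 1/2"
      by real_asymp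
    ultimately have "\<forall>\<^sub>F j in sequentially. a < ?u j \<and> q / s < real (j\<^sup>2) / real ((j + 1)\<^sup>2) \<and>
        q / real (j\<^sup>2) < 1/2 \<and> j > 0"
      using eventually_gt_at_top[of 0] by eventually_elim simp
    from eventually_compose_filterlim[OF this filterlim_floor_sqrt]
    show "\<forall>\<^sub>F N in sequentially. a < ?R N"
    proof eventually_elim
      case (elim N)
      define j where "j = floor_sqrt N"
      have j: "j > 0" "a < ?u j" "q / s < real (j\<^sup>2) / real ((j + 1)\<^sup>2)" "q / real (j\<^sup>2) < 1/2"
        using elim unfolding j_def by blast+
      have N: "j\<^sup>2 \<le> N" "N \<le> (j + 1)\<^sup>2" "N > 0"
        using floor_sqrt_power2_le[of N] Suc_floor_sqrt_power2_gt[of N] j(1) elim by (auto simp: j_def intro: gr0I)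
      have RN: "real (j\<^sup>2) \<le> real N" "real N \<le> real ((j+1)\<^sup>2)" "real (j\<^sup>2) > 0"
        using N j by (auto simp del: of_nat_power of_nat_add)
      have "q * real ((j + 1)\<^sup>2) \<le> s * real (j\<^sup>2)"
        using j(3) s by (simp add: field_simps del: of_nat_power of_nat_add)
      moreover have "q * real N \<le> q * real ((j + 1)\<^sup>2)" using RN q by (intro mult_left_mono) auto
      ultimately have "q / real (j\<^sup>2) \<le> s / real N"
        using RN N by (simp add: field_simps del: of_nat_power)
      then have *: "pair_count x (j\<^sup>2) (q / real (j\<^sup>2)) \<le> closed_pair_count x N (s / real N)"
        using order_trans[OF pair_count_le_closed closed_pair_count_mono[OF N(1)]] j(4) q by auto
      have pos: "closed_pair_count x N (s / real N) \<ge> 0"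
        by (auto simp: closed_pair_count_def intro!: sum_nonneg)
      have "?u j = pair_count x (j\<^sup>2) (q / real (j\<^sup>2)) / real ((j + 1)\<^sup>2)" using RN by simp
      also have "\<dots> \<le> closed_pair_count x N (s / real N) / real ((j + 1)\<^sup>2)"
        using * by (intro divide_right_mono) auto
      also have "\<dots> \<le> ?R N" using pos RN N by (intro divide_left_mono) auto
      finally show ?case using j(2) by linarith
    qed
  next
    fix a assume "s < a"
    \<comment> \<open>The upper bound uses the square above \<open>N\<close>. Here
      \<open>q > s\<close> also yields the strictly larger radius needed to pass from the closed to
      the half-open count.\<close>
    then obtain q where q: "q \<in> \<rat>" "s < q" "q < a"
      using Rats_dense_in_real[of s a] s by auto
    let ?w = "\<lambda>j::nat. pair_count x (j\<^sup>2) (q / real (j\<^sup>2)) / real (j\<^sup>2)"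
    let ?u = "\<lambda>j::nat. ?w (j + 1) * (real ((j + 1)\<^sup>2) / real (j\<^sup>2))"
    have "(\<lambda>j::nat. real ((j + 1)\<^sup>2) / real (j\<^sup>2)) \<longlonglongrightarrow> 1" by real_asymp
    moreover have "(\<lambda>j. ?w (j + 1)) \<longlonglongrightarrow> q"
      using conv[of q] q s by (intro LIMSEQ_ignore_initial_segment) auto
    ultimately have "?u \<longlonglongrightarrow> q * 1" by (intro tendsto_mult)
    then have "\<forall>\<^sub>F j in sequentially. ?u j < a" using q by (intro order_tendstoD) auto
    moreover have "\<forall>\<^sub>F j::nat in sequentially. real ((j + 1)\<^sup>2) / real (j\<^sup>2) < q / s"
      using q s by (intro order_tendstoD(2)[where y=1]) (real_asymp, simp)
    moreover have "\<forall>\<^sub>F j::nat in sequentially. q / real ((j + 1)\<^sup>2) < 1/2"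
      by real_asymp
    ultimately have "\<forall>\<^sub>F j in sequentially. ?u j < a \<and> real ((j + 1)\<^sup>2) / real (j\<^sup>2) < q / s \<and>
        q / real ((j + 1)\<^sup>2) < 1/2 \<and> j > 0"
      using eventually_gt_at_top[of 0] by eventually_elim simp
    from eventually_compose_filterlim[OF this filterlim_floor_sqrt]
    show "\<forall>\<^sub>F N in sequentially. ?R N < a"
    proof eventually_elim
      case (elim N)
      define j where "j = floor_sqrt N"
      have j: "j > 0" "?u j < a" "real ((j + 1)\<^sup>2) / real (j\<^sup>2) < q / s" "q / real ((j + 1)\<^sup>2) < 1/2"
        using elim unfolding j_def by blast+
      have N: "j\<^sup>2 \<le> N" "N \<le> (j + 1)\<^sup>2" "N > 0"
        using floor_sqrt_power2_le[of N] Suc_floor_sqrt_power2_gt[of N] j(1) elim by (auto simp: j_def intro: gr0I)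
      have RN: "real (j\<^sup>2) \<le> real N" "real N \<le> real ((j+1)\<^sup>2)" "real (j\<^sup>2) > 0" "real ((j+1)\<^sup>2) > 0"
        using N j by (auto simp del: of_nat_power of_nat_add)
      have "s * real ((j + 1)\<^sup>2) < q * real (j\<^sup>2)"
        using j(3) s RN by (simp add: field_simps del: of_nat_power of_nat_add)
      also have "\<dots> \<le> q * real N" using RN q s by (intro mult_left_mono) auto
      finally have "s / real N < q / real ((j + 1)\<^sup>2)"
        using RN N by (simp add: field_simps del: of_nat_power of_nat_add)
      then have *: "closed_pair_count x N (s / real N) \<le> pair_count x ((j + 1)\<^sup>2) (q / real ((j + 1)\<^sup>2))"
        using order_trans[OF closed_pair_count_mono[OF N(2) order_refl] closed_le_pair_count] j(4) s by auto
      have "closed_pair_count x N (s / real N) \<ge> 0"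
        by (auto simp: closed_pair_count_def intro!: sum_nonneg)
      then have "?R N \<le> closed_pair_count x N (s / real N) / real (j\<^sup>2)"
        using RN N by (intro divide_left_mono) auto
      also have "\<dots> \<le> pair_count x ((j + 1)\<^sup>2) (q / real ((j + 1)\<^sup>2)) / real (j\<^sup>2)"
        using * by (intro divide_right_mono) auto
      also have "\<dots> = ?u j" using RN by simp
      finally show ?case using j(2) by linarith
    qed
  qed
  then show "(\<lambda>N. 2 * closed_pair_count x N (s / real N) / real N) \<longlonglongrightarrow> 2 * s"
    using tendsto_mult_left[of ?R s sequentially 2] by simp
qed

section \<open>Almost sure convergence along the squares\<close>

text \<open>The sum of the \<open>f j\<close> has finite integral over \<open>{A..B}\<close>, so it
  is finite almost everywhere there, and the terms of a convergent series tend to 0.\<close>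

lemma AE_tendsto_zero_of_summable_integrals:
  fixes f :: "nat \<Rightarrow> real \<Rightarrow> real"
  assumes bb: "\<And>j. bounded_borel (f j)" and nonneg: "\<And>j \<alpha>. 0 \<le> f j \<alpha>"
    and le: "\<And>j. integral {A..B} (f j) \<le> c j" and c: "summable c"
  shows "AE \<alpha> in lborel. \<alpha> \<in> {A..B} \<longrightarrow> (\<lambda>j. f j \<alpha>) \<longlonglongrightarrow> 0"
proof -
  have [measurable]: "f j \<in> borel_measurable borel" for j using bb by (simp add: bounded_borel_def)
  have c0: "0 \<le> c j" for j
    using le[of j] integral_nonneg[OF bounded_borel_integrable[OF bb], of A B j] nonneg by fastforce
  let ?F = "\<lambda>\<alpha>. \<Sum>j. ennreal (f j \<alpha>) * indicator {A..B} \<alpha>"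
  have "(\<integral>\<^sup>+\<alpha>. ?F \<alpha> \<partial>lborel) = (\<Sum>j. \<integral>\<^sup>+\<alpha>. ennreal (f j \<alpha>) * indicator {A..B} \<alpha> \<partial>lborel)"
    by (intro nn_integral_suminf) measurable
  also have "\<dots> = (\<Sum>j. ennreal (integral {A..B} (f j)))"
    by (intro suminf_cong nn_integral_has_integral_lebesgue' nonneg integrable_integral bounded_borel_integrable bb)
  also have "\<dots> \<le> (\<Sum>j. ennreal (c j))"
    using le by (intro suminf_le ennreal_leI) auto
  also have "\<dots> = ennreal (suminf c)"
    using c c0 by (simp add: suminf_ennreal2)
  finally have "(\<integral>\<^sup>+\<alpha>. ?F \<alpha> \<partial>lborel) \<noteq> \<infinity>"
    by (metis ennreal_less_top infinity_ennreal_def leD)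
  then have "AE \<alpha> in lborel. ?F \<alpha> \<noteq> \<infinity>"
    by (intro nn_integral_noteq_infinite) measurable
  then show ?thesis
  proof eventually_elim
    case (elim \<alpha>)
    show ?case
    proof
      assume "\<alpha> \<in> {A..B}"
      then have "(\<Sum>j. ennreal (f j \<alpha>)) \<noteq> top" using elim by simp
      then show "(\<lambda>j. f j \<alpha>) \<longlonglongrightarrow> 0"
        by (intro summable_LIMSEQ_zero summable_suminf_not_top nonneg)
    qed
  qed
qed

context lacunary_family
begin

text \<open>There are \<open>N * (N - 1) / 2\<close> pairs, each with mean
  \<open>2 * \<delta>\<close>.\<close>

lemma total_eq_pair_count:
  "total \<delta> N \<alpha> = pair_count (\<lambda>n. x n \<alpha>) N \<delta> - \<delta> * (real N * (real N - 1))"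
proof (induction N)
  case 0
  then show ?case by (simp add: total_def pair_count_def)
next
  case (Suc N)
  have "total \<delta> (Suc N) \<alpha> = total \<delta> N \<alpha> + row \<delta> (Suc N) (Suc N) \<alpha>" by (simp add: total_def)
  also have "row \<delta> (Suc N) (Suc N) \<alpha> =
      (\<Sum>m=1..<Suc N. near_int \<delta> (x (Suc N) \<alpha> - x m \<alpha>)) - real N * (2 * \<delta>)"
    by (simp add: row_def osc_def sum_subtractf)
  finally show ?case unfolding Suc by (simp add: pair_count_def algebra_simps)
qed

text \<open>The normalised deviation has second moment of order \<open>1 / N\<close>, which is
  summable along the squares.\<close>

lemma AE_pair_count_tendsto:
  assumes s: "s > 0"
  shows "AE \<alpha> in lborel. \<alpha> \<in> {A..B} \<longrightarrow>
    (\<lambda>j. pair_count (\<lambda>n. x n \<alpha>) (j\<^sup>2) (s / real (j\<^sup>2)) / real (j\<^sup>2)) \<longlonglongrightarrow> s"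
proof -
  \<comment> \<open>The variance bound requires \<open>s / N < 1/4\<close>, so the first
    \<open>j0\<close> squares are skipped.\<close>
  obtain j0 :: nat where j0: "4 * s < real j0" "j0 > 0"
    using reals_Archimedean2[of "4 * s"] s by (metis gr0I less_asym mult_pos_pos of_nat_0 zero_less_numeral)
  define J where "J i = (i + j0)\<^sup>2" for i
  define f where "f i \<alpha> = (1 / real (J i) * total (s / real (J i)) (J i) \<alpha>)\<^sup>2" for i \<alpha>
  define C where "C = 4 * s * (B - A) + 24 * s\<^sup>2 * (B - A) + 2 * s * \<kappa> + 8 * (1 + B - A) * \<kappa>"
  have \<kappa>0: "\<kappa> \<ge> 0" using \<kappa>[of 0] by simp
  have J: "real (J i) > 0" "4 * s < real (J i)" "real (J i) \<ge> 1" for i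
  proof -
    have "j0 \<le> J i" using j0 by (auto simp: J_def power2_eq_square intro: order_trans[OF _ le_add2] le_trans[OF _ le_square])
    then have "real j0 \<le> real (J i)" by simp
    then show "real (J i) > 0" "4 * s < real (J i)" using j0 s by linarith+
    show "real (J i) \<ge> 1" using \<open>j0 \<le> J i\<close> j0 by simp
  qed
  have bb: "bounded_borel (f i)" for i
    unfolding f_def by (intro bounded_borel_power bounded_borel_mult bounded_borel_const bounded_borel_total)
  have le: "integral {A..B} (f i) \<le> C * (1 / real (J i))" for i
  proof -
    let ?N = "real (J i)" and ?\<delta> = "s / real (J i)"
    have "integral {A..B} (\<lambda>\<alpha>. (total ?\<delta> (J i) \<alpha>)\<^sup>2) \<le>
       ?N * (4 * ?\<delta> * (B - A) * ?N + 24 * ?\<delta>\<^sup>2 * (B - A) * ?N\<^sup>2 + 2 * ?\<delta> * \<kappa>) + 8 * (1 + B - A) * \<kappa>"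
      using J[of i] s by (intro integral_total_square) (auto simp: field_simps)
    also have "\<dots> = ?N * (4 * s * (B - A) + 24 * s\<^sup>2 * (B - A)) + 2 * s * \<kappa> + 8 * (1 + B - A) * \<kappa>"
      using J(1)[of i] by (simp add: field_simps power2_eq_square)
    also have "\<dots> \<le> ?N * (4 * s * (B - A) + 24 * s\<^sup>2 * (B - A)) + ?N * (2 * s * \<kappa>) + ?N * (8 * (1 + B - A) * \<kappa>)"
      using J(3)[of i] \<kappa>0 s AB mult_right_mono[OF J(3)[of i], of "2 * s * \<kappa>"]
        mult_right_mono[OF J(3)[of i], of "8 * (1 + B - A) * \<kappa>"] by (intro add_mono) auto
    also have "\<dots> = ?N * C" by (simp add: C_def algebra_simps)
    finally have *: "integral {A..B} (\<lambda>\<alpha>. (total ?\<delta> (J i) \<alpha>)\<^sup>2) \<le> ?N * C" .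
    have "integral {A..B} (f i) = (1 / ?N)\<^sup>2 * integral {A..B} (\<lambda>\<alpha>. (total ?\<delta> (J i) \<alpha>)\<^sup>2)"
      unfolding f_def power_mult_distrib by simp
    also have "\<dots> \<le> (1 / ?N)\<^sup>2 * (?N * C)" using * by (intro mult_left_mono) auto
    also have "\<dots> = C * (1 / ?N)" using J(1)[of i] by (simp add: field_simps power2_eq_square)
    finally show ?thesis .
  qed
  have "summable (\<lambda>j. 1 / real (j\<^sup>2))"
    using inverse_power_summable[of 2, where 'a=real] by (simp add: field_simps)
  then have "summable (\<lambda>i. C * (1 / real (J i)))"
    unfolding J_def by (intro summable_mult summable_ignore_initial_segment)
  then have "AE \<alpha> in lborel. \<alpha> \<in> {A..B} \<longrightarrow> (\<lambda>i. f i \<alpha>) \<longlonglongrightarrow> 0"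
    by (intro AE_tendsto_zero_of_summable_integrals[OF bb _ le]) (auto simp: f_def)
  then show ?thesis
  proof eventually_elim
    case (elim \<alpha>)
    show ?case
    proof
      assume "\<alpha> \<in> {A..B}"
      let ?p = "\<lambda>j::nat. pair_count (\<lambda>n. x n \<alpha>) (j\<^sup>2) (s / real (j\<^sup>2)) / real (j\<^sup>2)"
      have "(\<lambda>i. f i \<alpha>) \<longlonglongrightarrow> 0" using elim \<open>\<alpha> \<in> {A..B}\<close> by blast
      then have "(\<lambda>i. 1 / real (J i) * total (s / real (J i)) (J i) \<alpha>) \<longlonglongrightarrow> 0"
        unfolding f_def using tendsto_real_sqrt[of "\<lambda>i. (1 / real (J i) * total (s / real (J i)) (J i) \<alpha>)\<^sup>2" 0]
        by (simp add: tendsto_rabs_zero_iff)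
      \<comment> \<open>The centring term, divided by \<open>N\<close>, is
        \<open>s * (1 - 1 / N)\<close>, which itself tends to \<open>s\<close>.\<close>
      moreover have "1 / real (J i) * total (s / real (J i)) (J i) \<alpha> = ?p (i + j0) - s * (1 - 1 / real ((i + j0)\<^sup>2))" for i
        using J(1)[of i] unfolding total_eq_pair_count J_def[symmetric] by (simp add: field_simps)
      ultimately have "(\<lambda>i. ?p (i + j0) - s * (1 - 1 / real ((i + j0)\<^sup>2))) \<longlonglongrightarrow> 0" by simp
      then have "(\<lambda>j. ?p j - s * (1 - 1 / real (j\<^sup>2))) \<longlonglongrightarrow> 0"
        by (rule LIMSEQ_offset)
      moreover have "(\<lambda>j::nat. s * (1 - 1 / real (j\<^sup>2))) \<longlonglongrightarrow> s" by real_asymp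
      ultimately have "(\<lambda>j. (?p j - s * (1 - 1 / real (j\<^sup>2))) + s * (1 - 1 / real (j\<^sup>2))) \<longlonglongrightarrow> 0 + s"
        by (rule tendsto_add)
      then show "?p \<longlonglongrightarrow> s" by simp
    qed
  qed
qed

lemma AE_poissonian:
  "AE \<alpha> in lborel. \<alpha> \<in> {A..B} \<longrightarrow> poissonian_pair_correlations (\<lambda>n. x n \<alpha>)"
proof -
  have "AE \<alpha> in lborel. \<forall>s\<in>{s\<in>\<rat>. s > 0}. \<alpha> \<in> {A..B} \<longrightarrow>
    (\<lambda>j. pair_count (\<lambda>n. x n \<alpha>) (j\<^sup>2) (s / real (j\<^sup>2)) / real (j\<^sup>2)) \<longlonglongrightarrow> s"
  proof (subst AE_ball_countable)
    show "countable {s::real. s \<in> \<rat> \<and> s > 0}"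
      by (rule countable_subset[OF _ countable_rat]) auto
  qed (use AE_pair_count_tendsto in auto)
  then show ?thesis
    by eventually_elim (auto intro!: poissonian_of_squares)
qed

end

subsection \<open>Sequences with gaps in the exponents\<close>

text \<open>Up to the factor \<open>\<theta>\<close>, each difference has the derivative of its
  leading power \<open>\<alpha> ^ d n\<close>. The gap below \<open>d n\<close> is at least
  \<open>n - 1\<close>, so the derivatives separate by a factor of geometric growth in
  \<open>n\<close>, against which \<open>n ^ 3\<close> is summable.\<close>

lemma AE_poissonian_of_exponents:
  fixes x x' :: "nat \<Rightarrow> real \<Rightarrow> real" and d :: "nat \<Rightarrow> nat"
  assumes A: "1 < A" "A \<le> B" and \<theta>: "0 < \<theta>" "\<theta> \<le> 1"
    and d1: "1 \<le> d 1" and d: "\<And>n. 1 \<le> n \<Longrightarrow> d n + n \<le> d (Suc n)"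
    and der: "\<And>n \<alpha>. (x n has_real_derivative x' n \<alpha>) (at \<alpha>)"
    and mono: "\<And>m n. 1 \<le> d m \<Longrightarrow> d m < d n \<Longrightarrow> mono_on {A..B} (\<lambda>\<alpha>. x' n \<alpha> - x' m \<alpha>)"
    and lower: "\<And>m n \<alpha>. 1 \<le> d m \<Longrightarrow> d m < d n \<Longrightarrow> \<alpha> \<in> {A..B} \<Longrightarrow>
      \<theta> * (real (d n) * \<alpha> ^ (d n - 1)) \<le> x' n \<alpha> - x' m \<alpha>"
    and upper: "\<And>m n \<alpha>. 1 \<le> d m \<Longrightarrow> d m < d n \<Longrightarrow> \<alpha> \<in> {A..B} \<Longrightarrow>
      \<theta> * (x' n \<alpha> - x' m \<alpha>) \<le> real (d n) * \<alpha> ^ (d n - 1)"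
  shows "AE \<alpha> in lborel. \<alpha> \<in> {A..B} \<longrightarrow> poissonian_pair_correlations (\<lambda>n. x n \<alpha>)"
proof -
  \<comment> \<open>One factor \<open>\<theta>\<close> pays for the lower bound on the faster
    derivative, the other for the upper bound on the slower one. The quotient is
    \<open>A ^ (n - 1)\<close> for \<open>n \<ge> 1\<close>.\<close>
  define K where "K n = \<theta>\<^sup>2 * (A ^ n / A)" for n
  have K_pos: "K n > 0" for n using \<theta> A by (simp add: K_def)
  have gap: "d m + (n - 1) \<le> d n" if "1 \<le> m" "m < n" for m n
    using that
  proof (induction n)
    case (Suc n)
    then show ?case using d[of n] by (cases "m = n") auto
  qed simp
  have dm: "1 \<le> d m" if "1 \<le> m" for m
    using gap[of 1 m] d1 that by (cases "m = 1") auto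
  have dn: "d m < d n" if "1 \<le> m" "m < n" for m n using gap[OF that] that by auto
  have "summable (\<lambda>n. real n ^ 3 / K n)"
  proof (rule summable_comparison_test_bigo)
    show "summable (\<lambda>n. norm (1 / real n ^ 2))"
      using inverse_power_summable[of 2, where 'a=real] by (simp add: field_simps)
    show "(\<lambda>n. real n ^ 3 / K n) \<in> O(\<lambda>n. 1 / real n ^ 2)"
      unfolding K_def using A \<theta> by real_asymp
  qed
  then have \<kappa>: "(\<Sum>n=1..N. real n ^ 3 / K n) \<le> (\<Sum>n. real n ^ 3 / K n)" for N
    using K_pos by (intro sum_le_suminf) (auto intro!: divide_nonneg_pos)
  \<comment> \<open>The choice \<open>e = 1\<close> gives the lower bound on the derivative, and
    \<open>e = d n'\<close> gives the ratio condition.\<close>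
  have K_le: "K n * (real e * \<alpha> ^ (e - 1)) \<le> \<theta>\<^sup>2 * (real (d n) * \<alpha> ^ (d n - 1))"
    if "1 \<le> e" "e + (n - 1) \<le> d n" "1 \<le> n" "\<alpha> \<in> {A..B}" for n :: nat and e :: nat and \<alpha> :: real
  proof -
    have "A ^ n / A = A ^ (n - 1)" using that A by (cases n) auto
    also have "\<dots> \<le> \<alpha> ^ (n - 1)" using that A by (intro power_mono) auto
    finally have "K n * (real e * \<alpha> ^ (e - 1)) \<le> \<theta>\<^sup>2 * \<alpha> ^ (n - 1) * (real e * \<alpha> ^ (e - 1))"
      unfolding K_def using that A by (intro mult_right_mono mult_left_mono) auto
    also have "\<dots> = \<theta>\<^sup>2 * (real e * \<alpha> ^ (e + (n - 1) - 1))"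
      using that by (simp add: power_add[symmetric] add.commute)
    also have "\<dots> \<le> \<theta>\<^sup>2 * (real (d n) * \<alpha> ^ (d n - 1))"
      using that A by (intro mult_left_mono mult_mono power_increasing) auto
    finally show ?thesis .
  qed
  interpret lacunary_family x x' A B "\<Sum>n. real n ^ 3 / K n" K
  proof
    fix m n :: nat and \<alpha> :: real assume mn: "1 \<le> m" "m < n" and \<alpha>: "\<alpha> \<in> {A..B}"
    have low: "\<theta>\<^sup>2 * (real (d n) * \<alpha> ^ (d n - 1)) \<le> \<theta> * (x' n \<alpha> - x' m \<alpha>)"
      unfolding power2_eq_square mult.assoc
      using lower[OF dm[OF mn(1)] dn[OF mn] \<alpha>] \<theta> by (intro mult_left_mono) auto
    have "0 \<le> \<theta> * (real (d n) * \<alpha> ^ (d n - 1))" using \<theta> \<alpha> A by (intro mult_nonneg_nonneg) auto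
    then have pos: "0 \<le> x' n \<alpha> - x' m \<alpha>"
      using lower[OF dm[OF mn(1)] dn[OF mn] \<alpha>] by linarith
    have "K n * (real 1 * \<alpha> ^ (1 - 1)) \<le> \<theta>\<^sup>2 * (real (d n) * \<alpha> ^ (d n - 1))"
      using K_le[of 1 n \<alpha>] gap[of 1 n] d1 mn \<alpha> by simp
    then have "K n \<le> \<theta> * (x' n \<alpha> - x' m \<alpha>)" using low by simp
    also have "\<dots> \<le> 1 * (x' n \<alpha> - x' m \<alpha>)" using pos \<theta> by (intro mult_right_mono) auto
    finally show "K n \<le> x' n \<alpha> - x' m \<alpha>" by simp
    fix m' n' :: nat assume mn': "1 \<le> m'" "m' < n'" "n' < n"
    have "\<theta> * (K n * (x' n' \<alpha> - x' m' \<alpha>)) = K n * (\<theta> * (x' n' \<alpha> - x' m' \<alpha>))" by simp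
    also have "\<dots> \<le> K n * (real (d n') * \<alpha> ^ (d n' - 1))"
      using upper[OF dm[OF mn'(1)] dn[OF mn'(1,2)] \<alpha>] K_pos[of n] by (intro mult_left_mono) auto
    also have "\<dots> \<le> \<theta>\<^sup>2 * (real (d n) * \<alpha> ^ (d n - 1))"
      using K_le[of "d n'" n \<alpha>] gap[of n' n] dm[of n'] mn' \<alpha> by simp
    also note low
    finally show "K n * (x' n' \<alpha> - x' m' \<alpha>) \<le> x' n \<alpha> - x' m \<alpha>" using \<theta> by simp
  qed (use A K_pos der mono dm dn \<kappa> in auto)
  show ?thesis by (rule AE_poissonian)
qed

section \<open>Powers and geometric sums\<close>

text \<open>For \<open>\<alpha> \<ge> A\<close> the derivative of the smaller power is at most
  \<open>1 / A\<close> times that of the larger one, hence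
  \<open>\<theta> = 1 - 1 / A\<close>.\<close>

lemma AE_poissonian_powers:
  assumes A: "1 < A" "A \<le> B"
    and d1: "1 \<le> d 1" and d: "\<And>n. 1 \<le> n \<Longrightarrow> d n + n \<le> d (Suc n)"
  shows "AE \<alpha> in lborel. \<alpha> \<in> {A..B} \<longrightarrow> poissonian_pair_correlations (\<lambda>n. \<alpha> ^ d n)"
proof (rule AE_poissonian_of_exponents[where \<theta> = "1 - 1 / A" and d = d and x' = "\<lambda>n \<alpha>. real (d n) * \<alpha> ^ (d n - 1)"])
  show "((\<lambda>\<alpha>. \<alpha> ^ d n) has_real_derivative real (d n) * \<alpha> ^ (d n - 1)) (at \<alpha>)" for n \<alpha>
    by (auto intro!: derivative_eq_intros)
  fix m n assume mn: "1 \<le> d m" "d m < d n"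
  have split: "\<alpha> ^ (d n - 1) = \<alpha> ^ (d m - 1) * \<alpha> ^ (d n - d m)" for \<alpha> :: real
    using mn by (simp add: power_add[symmetric])
  show "mono_on {A..B} (\<lambda>\<alpha>. real (d n) * \<alpha> ^ (d n - 1) - real (d m) * \<alpha> ^ (d m - 1))"
  proof (rule mono_onI)
    fix u v assume uv: "u \<in> {A..B}" "v \<in> {A..B}" "u \<le> v"
    \<comment> \<open>Factoring out \<open>u ^ (d m - 1)\<close> leaves a product of two nonnegative
      nondecreasing functions; this inequality is the nonnegativity of the second.\<close>
    have "real (d m) * 1 \<le> real (d n) * u ^ (d n - d m)"
      using mn uv A by (intro mult_mono) (auto intro: one_le_power)
    then have "u ^ (d m - 1) * (real (d n) * u ^ (d n - d m) - d m) \<le> v ^ (d m - 1) * (real (d n) * v ^ (d n - d m) - d m)"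
      using uv A by (intro mult_mono power_mono diff_right_mono mult_left_mono) auto
    then show "real (d n) * u ^ (d n - 1) - real (d m) * u ^ (d m - 1) \<le> real (d n) * v ^ (d n - 1) - real (d m) * v ^ (d m - 1)"
      unfolding split by (simp add: algebra_simps)
  qed
  fix \<alpha> assume \<alpha>: "\<alpha> \<in> {A..B}"
  have "real (d m) * \<alpha> ^ (d m - 1) * A \<le> real (d n) * \<alpha> ^ (d m - 1) * \<alpha> ^ (d n - d m)"
    using mn \<alpha> A order_trans[OF _ self_le_power[of \<alpha> "d n - d m"], of A] by (intro mult_mono) auto
  also have "\<dots> = real (d n) * \<alpha> ^ (d n - 1)" unfolding split by simp
  finally show "(1 - 1 / A) * (real (d n) * \<alpha> ^ (d n - 1)) \<le> real (d n) * \<alpha> ^ (d n - 1) - real (d m) * \<alpha> ^ (d m - 1)"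
    using A by (simp add: field_simps)
  have "0 \<le> (real (d n) * \<alpha> ^ (d n - 1)) / A" "0 \<le> (1 - 1 / A) * (real (d m) * \<alpha> ^ (d m - 1))"
    using A \<alpha> by auto
  then show "(1 - 1 / A) * (real (d n) * \<alpha> ^ (d n - 1) - real (d m) * \<alpha> ^ (d m - 1)) \<le> real (d n) * \<alpha> ^ (d n - 1)"
    by (simp only: right_diff_distrib left_diff_distrib) simp
qed (use assms in auto)

text \<open>Consecutive terms grow by a factor of at least \<open>A\<close>, so the sum is dominated
  by a geometric series ending in its last term. This is the upper bound with
  \<open>\<theta> = 1 - 1 / A\<close>.\<close>

lemma geometric_deriv_le:
  fixes \<alpha> :: real
  assumes "1 < A" "A \<le> \<alpha>"
  shows "(A - 1) * (\<Sum>i=0..d. real i * \<alpha> ^ (i - 1)) \<le> A * (real d * \<alpha> ^ (d - 1))"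
proof (induction d)
  case (Suc d)
  have "A * (real d * \<alpha> ^ (d - 1)) \<le> real (Suc d) * \<alpha> ^ d"
  proof (cases d)
    case (Suc e)
    have "A * (real d * \<alpha> ^ (d - 1)) \<le> \<alpha> * (real (Suc d) * \<alpha> ^ (d - 1))"
      using assms by (intro mult_mono) auto
    then show ?thesis using Suc by (simp add: algebra_simps)
  qed simp
  then have "(A - 1) * (\<Sum>i=0..Suc d. real i * \<alpha> ^ (i - 1)) \<le> real (Suc d) * \<alpha> ^ d + (A - 1) * (real (Suc d) * \<alpha> ^ d)"
    using Suc by (simp add: distrib_left del: of_nat_Suc)
  then show ?case by (simp add: left_diff_distrib)
qed simp

text \<open>A difference of two geometric sums is the sum of the powers with exponents in
  \<open>{d m<..d n}\<close>. Its derivative is monotone term by term and at least that of the top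
  power alone.\<close>

lemma AE_poissonian_geometric_sums:
  assumes A: "1 < A" "A \<le> B"
    and d1: "1 \<le> d 1" and d: "\<And>n. 1 \<le> n \<Longrightarrow> d n + n \<le> d (Suc n)"
  shows "AE \<alpha> in lborel. \<alpha> \<in> {A..B} \<longrightarrow> poissonian_pair_correlations (\<lambda>n. \<Sum>i=0..d n. \<alpha> ^ i)"
proof (rule AE_poissonian_of_exponents[where \<theta> = "1 - 1 / A" and d = d and
      x' = "\<lambda>n \<alpha>. \<Sum>i=0..d n. real i * \<alpha> ^ (i - 1)"])
  show "((\<lambda>\<alpha>. \<Sum>i=0..d n. \<alpha> ^ i) has_real_derivative (\<Sum>i=0..d n. real i * \<alpha> ^ (i - 1))) (at \<alpha>)" for n \<alpha>
    by (auto intro!: derivative_eq_intros sum.cong)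
  fix m n assume mn: "1 \<le> d m" "d m < d n"
  have diff: "(\<Sum>i=0..d n. real i * \<alpha> ^ (i - 1)) - (\<Sum>i=0..d m. real i * \<alpha> ^ (i - 1)) =
      (\<Sum>i\<in>{d m<..d n}. real i * \<alpha> ^ (i - 1))" for \<alpha>
  proof -
    have "{0..d n} = {0..d m} \<union> {d m<..d n}" using mn by auto
    then show ?thesis by (simp add: sum.union_disjoint ivl_disj_int)
  qed
  show "mono_on {A..B} (\<lambda>\<alpha>. (\<Sum>i=0..d n. real i * \<alpha> ^ (i - 1)) - (\<Sum>i=0..d m. real i * \<alpha> ^ (i - 1)))"
    unfolding diff using A by (intro mono_onI sum_mono mult_left_mono power_mono) auto
  fix \<alpha> assume \<alpha>: "\<alpha> \<in> {A..B}"
  have "(1 - 1 / A) * (real (d n) * \<alpha> ^ (d n - 1)) \<le> 1 * (real (d n) * \<alpha> ^ (d n - 1))"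
    using A \<alpha> by (intro mult_right_mono) auto
  also have "\<dots> \<le> (\<Sum>i\<in>{d m<..d n}. real i * \<alpha> ^ (i - 1))"
    using mn A \<alpha> member_le_sum[of "d n" "{d m<..d n}" "\<lambda>i. real i * \<alpha> ^ (i - 1)"] by auto
  finally show "(1 - 1 / A) * (real (d n) * \<alpha> ^ (d n - 1)) \<le>
      (\<Sum>i=0..d n. real i * \<alpha> ^ (i - 1)) - (\<Sum>i=0..d m. real i * \<alpha> ^ (i - 1))"
    unfolding diff .
  have "(1 - 1 / A) * ((\<Sum>i=0..d n. real i * \<alpha> ^ (i - 1)) - (\<Sum>i=0..d m. real i * \<alpha> ^ (i - 1)))
     \<le> (1 - 1 / A) * (\<Sum>i=0..d n. real i * \<alpha> ^ (i - 1))"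
    using A \<alpha> by (intro mult_left_mono) (auto intro!: sum_nonneg)
  also have "\<dots> \<le> real (d n) * \<alpha> ^ (d n - 1)"
    using geometric_deriv_le[of A \<alpha> "d n"] A \<alpha> by (simp add: field_simps)
  finally show "(1 - 1 / A) * ((\<Sum>i=0..d n. real i * \<alpha> ^ (i - 1)) - (\<Sum>i=0..d m. real i * \<alpha> ^ (i - 1)))
     \<le> real (d n) * \<alpha> ^ (d n - 1)" .
qed (use assms in auto)

section \<open>From compact intervals to the half-line\<close>

text \<open>Countably many compact intervals with left endpoints above 1 exhaust the half-line;
  passing to the completion turns a Borel null set into a Lebesgue one.\<close>

lemma AE_gt_one_of_intervals:
  assumes "\<And>A B::real. 1 < A \<Longrightarrow> A \<le> B \<Longrightarrow> AE \<alpha> in lborel. \<alpha> \<in> {A..B} \<longrightarrow> P \<alpha>"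
  shows "AE \<alpha> in lebesgue. \<alpha> > 1 \<longrightarrow> P \<alpha>"
proof -
  have "AE \<alpha> in lborel. \<forall>i::nat. \<alpha> \<in> {1 + 1 / real (Suc i)..2 + real i} \<longrightarrow> P \<alpha>"
    unfolding AE_all_countable by (intro allI assms) (auto simp: field_simps)
  then have "AE \<alpha> in lborel. \<alpha> > 1 \<longrightarrow> P \<alpha>"
  proof eventually_elim
    case (elim \<alpha>)
    show ?case
    proof
      assume \<alpha>: "\<alpha> > 1"
      have "\<forall>\<^sub>F i in sequentially. 1 + 1 / real (Suc i) < \<alpha>"
        using \<alpha> by (intro order_tendstoD(2)[where y=1]) real_asymp
      moreover have "\<forall>\<^sub>F i in sequentially. \<alpha> < 2 + real i" by real_asymp
      ultimately have "\<forall>\<^sub>F i in sequentially. 1 + 1 / real (Suc i) < \<alpha> \<and> \<alpha> < 2 + real i"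
        by (rule eventually_conj)
      then obtain i where "1 + 1 / real (Suc i) < \<alpha>" "\<alpha> < 2 + real i"
        using eventually_happens'[OF sequentially_bot] by blast
      then show "P \<alpha>" using elim by (meson atLeastAtMost_iff less_imp_le)
    qed
  qed
  then show ?thesis by (rule AE_completion)
qed

text \<open>One factor \<open>Suc n\<close> is split as \<open>n + 1\<close>: the first part yields
  \<open>n ^ k\<close>, and the second leaves a power of \<open>Suc n\<close> with positive
  exponent, because \<open>k \<ge> 2\<close>.\<close>

lemma power_gap:
  fixes n k :: nat
  assumes "2 \<le> k"
  shows "n ^ k + n \<le> Suc n ^ k"
proof -
  obtain l where k: "k = Suc (Suc l)" using assms by (metis Suc_le_D numeral_2_eq_2 Suc_le_mono)
  have "n ^ Suc l \<le> Suc n ^ Suc l" by (rule power_mono) auto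
  then have "n * n ^ Suc l \<le> n * Suc n ^ Suc l" by simp
  moreover have "n \<le> Suc n ^ Suc l" by (rule order_trans[OF _ self_le_power]) auto
  ultimately have "n * n ^ Suc l + n \<le> n * Suc n ^ Suc l + Suc n ^ Suc l" by (rule add_mono)
  then show ?thesis unfolding k by (simp add: algebra_simps)
qed

theorem theorem1p4:
  shows "(AE \<alpha> in lebesgue. (\<alpha>::real) > 1 \<longrightarrow>
            (\<forall>k::nat. k \<ge> 2 \<longrightarrow>
               poissonian_pair_correlations (\<lambda>n. \<alpha> ^ (n ^ k)) \<and>
               poissonian_pair_correlations (\<lambda>n. \<Sum>i=0..n ^ k. \<alpha> ^ i)))
       \<and> (AE \<alpha> in lebesgue. (\<alpha>::real) > 1 \<longrightarrow>
            poissonian_pair_correlations (\<lambda>n. \<alpha> ^ (fact n :: nat)))"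
proof (intro conjI AE_gt_one_of_intervals)
  fix A B :: real assume A: "1 < A" "A \<le> B"
  have "AE \<alpha> in lborel. \<alpha> \<in> {A..B} \<longrightarrow>
      poissonian_pair_correlations (\<lambda>n. \<alpha> ^ (n ^ k)) \<and>
      poissonian_pair_correlations (\<lambda>n. \<Sum>i=0..n ^ k. \<alpha> ^ i)" if k: "k \<ge> 2" for k :: nat
    using AE_poissonian_powers[OF A, of "\<lambda>n. n ^ k"] AE_poissonian_geometric_sums[OF A, of "\<lambda>n. n ^ k"]
      power_gap[OF k] by auto
  \<comment> \<open>There are countably many \<open>k\<close>, so one null set serves all of
    them.\<close>
  then have "AE \<alpha> in lborel. \<forall>k::nat. k \<ge> 2 \<longrightarrow> \<alpha> \<in> {A..B} \<longrightarrow>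
      poissonian_pair_correlations (\<lambda>n. \<alpha> ^ (n ^ k)) \<and>
      poissonian_pair_correlations (\<lambda>n. \<Sum>i=0..n ^ k. \<alpha> ^ i)"
    unfolding AE_all_countable by (auto intro: AE_I2)
  then show "AE \<alpha> in lborel. \<alpha> \<in> {A..B} \<longrightarrow> (\<forall>k::nat. k \<ge> 2 \<longrightarrow>
      poissonian_pair_correlations (\<lambda>n. \<alpha> ^ (n ^ k)) \<and>
      poissonian_pair_correlations (\<lambda>n. \<Sum>i=0..n ^ k. \<alpha> ^ i))"
    by eventually_elim blast
next
  fix A B :: real assume A: "1 < A" "A \<le> B"
  have "fact n + n \<le> (fact (Suc n) :: nat)" if "1 \<le> n" for n
  proof -
    \<comment> \<open>The gap between consecutive factorials is \<open>n * fact n\<close>, which is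
      at least \<open>n\<close>.\<close>
    have "n * 1 \<le> n * (fact n :: nat)" by (intro mult_left_mono) auto
    then show ?thesis by simp
  qed
  then show "AE \<alpha> in lborel. \<alpha> \<in> {A..B} \<longrightarrow> poissonian_pair_correlations (\<lambda>n. \<alpha> ^ (fact n :: nat))"
    by (intro AE_poissonian_powers A) auto
qed

end
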